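(* Let $(T,\Sigma,\mu)$ be a non-atomic, $\sigma$-finite measure space and $\Phi$ a Musielak--Orlicz function on $T$. The norm of any functional $f=f_v+f_{\mathrm s}\in(L_0^\Phi)^*$ (with order continuous component $f_v$, $v\in L^{\Phi^*}$, and singular component $f_{\mathrm s}$) can be expressed as $$\|f\|=\inf\{\lambda>0:I_{\Phi^*}(v/\lambda)+\|f_{\mathrm s}/\lambda\|\le1\}.$$
   Context: A function $\Phi\colon T\times[0,\infty]\to[0,\infty]$ is a Musielak--Orlicz function if, for $\mu$-a.e. $t\in T$: (i) $\Phi(t,\cdot)$ is convex and lower semi-continuous; (ii) $\Phi(t,0)=\lim_{u\downarrow0}\Phi(t,u)=0$ and $\Phi(t,\infty)=\infty$; and (iii) $\Phi(\cdot,u)$ is measurable for all $u\ge0$. The complementary function is $\Phi^*(t,v)=\sup_{u>0}(uv-\Phi(t,u))$, $v\ge0$; it is again a Musielak--Orlicz function. $L^0$ is the space of real-valued measurable functions on $T$ (equality $\mu$-a.e.), $I_\Phi(u)=\int_T\Phi(t,|u(t)|)\,d\mu$, $L^\Phi=\{u\in L^0: I_\Phi(\lambda u)<\infty\text{ for some }\lambda>0\}$, $\tilde L^\Phi=\{u\in L^0:I_\Phi(u)<\infty\}$. The Orlicz norm is $\|u\|_{\Phi,0}=\sup\{|\int_T uv\,d\mu|: v\in\tilde L^{\Phi^*},\ I_{\Phi^*}(v)\le1\}$; it coincides on $L^\Phi$ with the Amemiya norm $\inf_{k>0}\frac1k(1+I_\Phi(ku))$. $L_0^\Phi$ is the Banach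 space $L^\Phi$ with the norm $\|\cdot\|_{\Phi,0}$. For $f\in(L_0^\Phi)^*$, $\|f\|=\sup_{u\in L_0^\Phi\setminus\{0\}}|f(u)|/\|u\|_{\Phi,0}$. For $v\in L^{\Phi^*}$, $f_v(u)=\int_T uv\,d\mu$. Every $f\in(L^\Phi)^*$ decomposes uniquely as $f=f_{\mathrm c}+f_{\mathrm s}$, where $f_{\mathrm c}=f_v$ for some $v\in L^{\Phi^*}$ (order continuous component) and $f_{\mathrm s}$ (singular component) is purely singular, i.e. has zero order continuous component. For a positive functional $f$ and $0\le u\in L^\Phi$, $f_{\mathrm c}(u)=\inf\{\sup_n f(u_n):0\le u_n\uparrow u\}$ and $f_{\mathrm s}(u)=\sup\{\inf_n f(u_n):u\ge u_n\downarrow0\}$; for general $f$ one uses the positive and negative parts. *)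

theory Defs
  imports "HOL-Analysis.Analysis"
begin

definition nonatomic :: "'a measure \<Rightarrow> bool" where
  "nonatomic M \<longleftrightarrow>
    (\<forall>A\<in>sets M. 0 < emeasure M A \<longrightarrow>
      (\<exists>B\<in>sets M. B \<subseteq> A \<and> 0 < emeasure M B \<and> emeasure M B < emeasure M A))"

definition musielak_orlicz :: "'a measure \<Rightarrow> ('a \<Rightarrow> ennreal \<Rightarrow> ennreal) \<Rightarrow> bool" where
  "musielak_orlicz M \<Phi> \<longleftrightarrow>
    (AE t in M.
      (\<forall>x y a b. a + b = 1 \<longrightarrow> \<Phi> t (a * x + b * y) \<le> a * \<Phi> t x + b * \<Phi> t y) \<and>
      (\<forall>x. \<Phi> t x \<le> Liminf (at x) (\<Phi> t)) \<and>
      \<Phi> t 0 = 0 \<and> (\<Phi> t \<longlongrightarrow> 0) (at_right 0) \<and> \<Phi> t \<infinity> = \<infinity>) \<and>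
    (\<forall>u. (\<lambda>t. \<Phi> t u) \<in> borel_measurable M)"

(* The supremum runs over finite u, where u * v - \<Phi> t u is meaningful.  Subtraction on ennreal
   truncates at 0; this does not change the supremum wherever \<Phi> t u \<rightarrow> 0 as u \<down> 0. *)
definition complementary :: "('a \<Rightarrow> ennreal \<Rightarrow> ennreal) \<Rightarrow> 'a \<Rightarrow> ennreal \<Rightarrow> ennreal" where
  "complementary \<Phi> t v = (SUP u\<in>{0<..<\<infinity>}. u * v - \<Phi> t u)"

definition modular :: "'a measure \<Rightarrow> ('a \<Rightarrow> ennreal \<Rightarrow> ennreal) \<Rightarrow> ('a \<Rightarrow> real) \<Rightarrow> ennreal" where
  "modular M \<Phi> u = (\<integral>\<^sup>+ t. \<Phi> t (ennreal \<bar>u t\<bar>) \<partial>M)"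

(* Elements of the spaces are functions rather than classes modulo equality almost everywhere;
   order, zero and equality are therefore taken almost everywhere below. *)
definition orlicz_space :: "'a measure \<Rightarrow> ('a \<Rightarrow> ennreal \<Rightarrow> ennreal) \<Rightarrow> ('a \<Rightarrow> real) set" where
  "orlicz_space M \<Phi> =
    {u \<in> borel_measurable M. \<exists>l>0. modular M \<Phi> (\<lambda>t. l * u t) < \<infinity>}"

definition orlicz_class :: "'a measure \<Rightarrow> ('a \<Rightarrow> ennreal \<Rightarrow> ennreal) \<Rightarrow> ('a \<Rightarrow> real) set" where
  "orlicz_class M \<Phi> = {u \<in> borel_measurable M. modular M \<Phi> u < \<infinity>}"

definition orlicz_norm :: "'a measure \<Rightarrow> ('a \<Rightarrow> ennreal \<Rightarrow> ennreal) \<Rightarrow> ('a \<Rightarrow> real) \<Rightarrow> ennreal" where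
  "orlicz_norm M \<Phi> u =
    (SUP v\<in>{v \<in> orlicz_class M (complementary \<Phi>). modular M (complementary \<Phi>) v \<le> 1}.
      ennreal \<bar>\<integral>t. u t * v t \<partial>M\<bar>)"

definition functional_norm ::
  "'a measure \<Rightarrow> ('a \<Rightarrow> ennreal \<Rightarrow> ennreal) \<Rightarrow> (('a \<Rightarrow> real) \<Rightarrow> real) \<Rightarrow> ennreal" where
  "functional_norm M \<Phi> f =
    (SUP u\<in>{u \<in> orlicz_space M \<Phi>. \<not> (AE t in M. u t = 0)}. ennreal \<bar>f u\<bar> / orlicz_norm M \<Phi> u)"

definition orlicz_dual ::
  "'a measure \<Rightarrow> ('a \<Rightarrow> ennreal \<Rightarrow> ennreal) \<Rightarrow> (('a \<Rightarrow> real) \<Rightarrow> real) set" where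
  "orlicz_dual M \<Phi> =
    {f. (\<forall>u\<in>orlicz_space M \<Phi>. \<forall>w\<in>orlicz_space M \<Phi>. (AE t in M. u t = w t) \<longrightarrow> f u = f w) \<and>
        (\<forall>u\<in>orlicz_space M \<Phi>. \<forall>w\<in>orlicz_space M \<Phi>. f (\<lambda>t. u t + w t) = f u + f w) \<and>
        (\<forall>c. \<forall>u\<in>orlicz_space M \<Phi>. f (\<lambda>t. c * u t) = c * f u) \<and>
        functional_norm M \<Phi> f < \<infinity>}"

(* Extension of an additive function on the positive cone to all of the space. *)
definition cone_extension :: "(('a \<Rightarrow> real) \<Rightarrow> real) \<Rightarrow> ('a \<Rightarrow> real) \<Rightarrow> real" where
  "cone_extension p u = p (\<lambda>t. max (u t) 0) - p (\<lambda>t. max (- u t) 0)"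

definition functional_pos_part ::
  "'a measure \<Rightarrow> ('a \<Rightarrow> ennreal \<Rightarrow> ennreal) \<Rightarrow> (('a \<Rightarrow> real) \<Rightarrow> real) \<Rightarrow> ('a \<Rightarrow> real) \<Rightarrow> real" where
  "functional_pos_part M \<Phi> f =
    cone_extension (\<lambda>u. SUP w\<in>{w \<in> orlicz_space M \<Phi>. AE t in M. 0 \<le> w t \<and> w t \<le> u t}. f w)"

definition functional_neg_part ::
  "'a measure \<Rightarrow> ('a \<Rightarrow> ennreal \<Rightarrow> ennreal) \<Rightarrow> (('a \<Rightarrow> real) \<Rightarrow> real) \<Rightarrow> ('a \<Rightarrow> real) \<Rightarrow> real" where
  "functional_neg_part M \<Phi> f = functional_pos_part M \<Phi> (\<lambda>u. - f u)"

definition increasing_to ::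
  "'a measure \<Rightarrow> ('a \<Rightarrow> ennreal \<Rightarrow> ennreal) \<Rightarrow> ('a \<Rightarrow> real) \<Rightarrow> (nat \<Rightarrow> 'a \<Rightarrow> real) set" where
  "increasing_to M \<Phi> u =
    {U. (\<forall>n. U n \<in> orlicz_space M \<Phi>) \<and>
        (AE t in M. (\<forall>n. 0 \<le> U n t) \<and> incseq (\<lambda>n. U n t) \<and> (\<lambda>n. U n t) \<longlonglongrightarrow> u t)}"

definition oc_component_of_positive ::
  "'a measure \<Rightarrow> ('a \<Rightarrow> ennreal \<Rightarrow> ennreal) \<Rightarrow> (('a \<Rightarrow> real) \<Rightarrow> real) \<Rightarrow> ('a \<Rightarrow> real) \<Rightarrow> real" where
  "oc_component_of_positive M \<Phi> g =
    cone_extension (\<lambda>u. INF U\<in>increasing_to M \<Phi> u. SUP n. g (U n))"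

definition oc_component ::
  "'a measure \<Rightarrow> ('a \<Rightarrow> ennreal \<Rightarrow> ennreal) \<Rightarrow> (('a \<Rightarrow> real) \<Rightarrow> real) \<Rightarrow> ('a \<Rightarrow> real) \<Rightarrow> real" where
  "oc_component M \<Phi> f u =
    oc_component_of_positive M \<Phi> (functional_pos_part M \<Phi> f) u -
    oc_component_of_positive M \<Phi> (functional_neg_part M \<Phi> f) u"

definition purely_singular ::
  "'a measure \<Rightarrow> ('a \<Rightarrow> ennreal \<Rightarrow> ennreal) \<Rightarrow> (('a \<Rightarrow> real) \<Rightarrow> real) \<Rightarrow> bool" where
  "purely_singular M \<Phi> f \<longleftrightarrow> (\<forall>u\<in>orlicz_space M \<Phi>. oc_component M \<Phi> f u = 0)"

end

theory Submission
  imports Defs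
begin

text \<open>
  Up to an error \<open>\<epsilon>\<close>, a purely singular functional \<open>f\<^sub>s\<close> sees a fixed \<open>u\<close> only through its restriction to
  sets \<open>A\<^sub>n\<close> shrinking to a null set, whereas \<open>f\<^sub>v\<close> does not see these restrictions in the limit.
  If \<open>I\<^sub>\<Psi>(v) + \<parallel>f\<^sub>s\<parallel> \<le> 1\<close>, where \<open>\<Psi>\<close> is complementary to \<open>\<Phi>\<close>, choose \<open>v'\<close> with \<open>I\<^sub>\<Psi>(v') \<le> 1\<close> almost norming
  \<open>u 1\<^bsub>A\<^sub>n\<^esub>\<close>; the function equal to \<open>v\<close> off \<open>A\<^sub>n\<close> and to \<open>\<parallel>f\<^sub>s\<parallel> v'\<close> on \<open>A\<^sub>n\<close> has modular at most \<open>1\<close> and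
  shows \<open>f(u) \<le> \<parallel>u\<parallel>\<close>, so that the Amemiya formula is not needed. Conversely, testing \<open>f\<close> on the function
  equal to \<open>u\<close> off \<open>A\<^sub>n\<close> and to \<open>w\<close> on \<open>A\<^sub>n\<close> gives \<open>\<integral>uv - I\<^sub>\<Phi>(u) + f\<^sub>s(w) \<le> 1\<close> for all \<open>u\<close>, \<open>w\<close> of finite
  modular. The supremum over \<open>u\<close> is \<open>I\<^sub>\<Psi>(v) + f\<^sub>s(w)\<close>, and the \<open>w\<close> of finite modular suffice to compute
  \<open>\<parallel>f\<^sub>s\<parallel>\<close> because \<open>\<parallel>w\<parallel> \<le> 1\<close> implies \<open>I\<^sub>\<Phi>(w) \<le> 1\<close>.
\<close>

section \<open>Conjugates of Young functions\<close>

text \<open>Enumerates the nonnegative rationals, with repetitions. Suprema over it are countable,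
  which is what later makes conjugates measurable in \<open>t\<close>.\<close>

definition nnrat :: "nat \<Rightarrow> real" where
  "nnrat i = \<bar>real_of_rat (nat_to_rat_surj i)\<bar>"

lemma nnrat_nonneg [simp]: "0 \<le> nnrat i"
  by (simp add: nnrat_def)

lemma nnrat_dense:
  assumes "0 \<le> x" "x < y" shows "\<exists>i. x < nnrat i \<and> nnrat i < y"
proof -
  obtain r where r: "x < real_of_rat r" "real_of_rat r < y"
    using of_rat_dense[OF assms(2)] by blast
  obtain i where "nat_to_rat_surj i = r" by (metis surj_def surj_nat_to_rat_surj)
  moreover have "0 < real_of_rat r" using r assms by linarith
  ultimately have "nnrat i = real_of_rat r" unfolding nnrat_def by simp
  then show ?thesis using r by metis
qed

text \<open>The convexity inequality with one endpoint at the origin, including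
  \<open>g 0 = 0\<close> (take \<open>c = 0\<close>). It yields monotonicity and, in suprema of
  \<open>x * w - g x\<close>, does the work of continuity.\<close>

definition star_shaped :: "(ennreal \<Rightarrow> ennreal) \<Rightarrow> bool" where
  "star_shaped g \<longleftrightarrow> (\<forall>c x. 0 \<le> c \<and> c \<le> 1 \<and> 0 \<le> x \<longrightarrow>
     g (ennreal (c * x)) \<le> ennreal c * g (ennreal x))"

text \<open>The value at \<open>th * x\<close> is at least \<open>th\<close> times the value at
  \<open>x\<close>, so rational points \<open>th * x\<close> with \<open>th\<close> just below 1
  come arbitrarily close to the value at \<open>x\<close>.\<close>

lemma star_shaped_SUP_nnrat:
  assumes star: "star_shaped g" and x: "0 \<le> x" and w: "0 \<le> w"
  shows "ennreal (x * w) - g (ennreal x) \<le> (SUP i. ennreal (nnrat i * w) - g (ennreal (nnrat i)))"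
    (is "_ \<le> ?S")
proof (cases "x = 0")
  case True
  then show ?thesis by (simp)
next
  case False
  then have x0: "0 < x" using x by simp
  show ?thesis
  proof (rule dense_le)
    fix y assume y: "y < ennreal (x * w) - g (ennreal x)"
    have fin: "g (ennreal x) \<noteq> \<infinity>" using y by (auto simp: ennreal_minus_top)
    then obtain gx where gx: "g (ennreal x) = ennreal gx" "0 \<le> gx"
      by (cases "g (ennreal x)") auto
    let ?c = "x * w - gx"
    have y': "y < ennreal ?c" using y gx by (simp add: ennreal_minus)
    then obtain y1 where y1: "y = ennreal y1" "0 \<le> y1" by (cases y) auto
    have c: "y1 < ?c" using y' y1 by (simp add: ennreal_less_iff)
    have c0: "0 < ?c" using c y1 by simp
    \<comment> \<open>Every factor \<open>th\<close> above \<open>y1 / ?c\<close> keeps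
      \<open>th * ?c\<close> above \<open>y1\<close>; a rational point is sought between this
      fraction of \<open>x\<close> and \<open>x\<close> itself.\<close>
    have "y1 / ?c < 1" using c c0 by simp
    then have "y1 / ?c * x < x" using mult_strict_right_mono[OF _ x0, of "y1 / ?c" 1] by simp
    moreover have "0 \<le> y1 / ?c * x" using c0 y1 x0 by simp
    ultimately obtain i where i: "y1 / ?c * x < nnrat i" "nnrat i < x"
      using nnrat_dense by blast
    define th where "th = nnrat i / x"
    have th: "0 \<le> th" "th \<le> 1" "th * x = nnrat i" using i x0 by (auto simp: th_def field_simps)
    have "y1 / ?c < th" using i(1) x0 by (simp add: th_def field_simps)
    then have y1th: "y1 < th * ?c" using c0 by (simp add: field_simps)
    have "g (ennreal (nnrat i)) \<le> ennreal th * g (ennreal x)"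
      using star th x unfolding star_shaped_def by metis
    also have "\<dots> = ennreal (th * gx)" using gx th by (simp add: ennreal_mult)
    finally have *: "g (ennreal (nnrat i)) \<le> ennreal (th * gx)" .
    have "y \<le> ennreal (nnrat i * w - th * gx)"
      using y1 y1th th(3) by (simp add: algebra_simps flip: th(3))
    also have "\<dots> = ennreal (nnrat i * w) - ennreal (th * gx)"
      using th gx by (simp add: ennreal_minus)
    also have "\<dots> \<le> ennreal (nnrat i * w) - g (ennreal (nnrat i))"
      using * by (rule ennreal_minus_mono[OF order_refl])
    also have "\<dots> \<le> ?S" by (rule SUP_upper) simp
    finally show "y \<le> ?S" .
  qed
qed

section \<open>Conjugation at a fixed point of the measure space\<close>

definition conjugate :: "(ennreal \<Rightarrow> ennreal) \<Rightarrow> ennreal \<Rightarrow> ennreal" where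
  "conjugate g v = (SUP u\<in>{0<..<\<infinity>}. u * v - g u)"

lemma complementary_eq_conjugate: "complementary \<Phi> t = conjugate (\<Phi> t)"
  by (simp add: complementary_def conjugate_def fun_eq_iff)

lemma conjugate_upper:
  assumes "0 \<le> u" "0 \<le> v"
  shows "ennreal (u * v) - g (ennreal u) \<le> conjugate g (ennreal v)"
proof (cases "u = 0")
  case False
  then have "ennreal u * ennreal v - g (ennreal u) \<le> conjugate g (ennreal v)"
    unfolding conjugate_def using assms
    by (intro SUP_upper) (auto simp: ennreal_less_zero_iff)
  then show ?thesis using assms by (simp add: ennreal_mult)
qed simp

lemma conjugate_least:
  assumes "0 \<le> v" "\<And>u. 0 < u \<Longrightarrow> ennreal (u * v) - g (ennreal u) \<le> C"
  shows "conjugate g (ennreal v) \<le> C"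
  unfolding conjugate_def
proof (rule SUP_least)
  fix u :: ennreal assume "u \<in> {0<..<\<infinity>}"
  then obtain u' where "u = ennreal u'" "0 < u'" by (cases u) (auto simp: ennreal_less_zero_iff)
  then show "u * ennreal v - g u \<le> C" using assms by (simp add: ennreal_mult)
qed

lemma Young_inequality:
  assumes "0 \<le> u" "0 \<le> v"
  shows "ennreal (u * v) \<le> g (ennreal u) + conjugate g (ennreal v)"
  using conjugate_upper[OF assms, of g] by (simp add: ennreal_minus_le_iff)

lemma ennreal_diff_scale:
  assumes "0 \<le> c" "0 \<le> x"
  shows "ennreal c * ennreal x - ennreal c * b = ennreal c * (ennreal x - b)"
proof (cases b)
  case (real r)
  then have "ennreal c * ennreal x - ennreal c * b = ennreal (c * x - c * r)"
    using assms by (simp add: ennreal_minus flip: ennreal_mult)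
  also have "\<dots> = ennreal c * ennreal (x - r)"
    using assms by (subst ennreal_mult'[symmetric]) (simp_all only: right_diff_distrib)
  finally show ?thesis using real by (simp add: ennreal_minus)
next
  case top
  then show ?thesis by (cases "c = 0") (auto simp: ennreal_mult_top ennreal_minus_top assms simp flip: ennreal_mult)
qed

text \<open>For \<open>c \<le> 1\<close>, replacing the subtrahend \<open>g u\<close> by
  \<open>c * g u\<close> can only increase the difference, and then \<open>c\<close> factors
  out.\<close>

lemma star_shaped_conjugate: "star_shaped (conjugate g)"
  unfolding star_shaped_def
proof (intro allI impI)
  fix c x :: real assume a: "0 \<le> c \<and> c \<le> 1 \<and> 0 \<le> x"
  show "conjugate g (ennreal (c * x)) \<le> ennreal c * conjugate g (ennreal x)"
  proof (rule conjugate_least)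
    fix u :: real assume u: "0 < u"
    have "ennreal (u * (c * x)) - g (ennreal u) \<le> ennreal c * ennreal (u * x) - ennreal c * g (ennreal u)"
    proof (rule ennreal_minus_mono)
      show "ennreal (u * (c * x)) \<le> ennreal c * ennreal (u * x)"
        using a u by (simp add: ac_simps flip: ennreal_mult)
      show "ennreal c * g (ennreal u) \<le> g (ennreal u)"
        using a mult_right_mono[of "ennreal c" 1 "g (ennreal u)"] by simp
    qed
    also have "\<dots> = ennreal c * (ennreal (u * x) - g (ennreal u))"
      using a u by (intro ennreal_diff_scale) auto
    also have "\<dots> \<le> ennreal c * conjugate g (ennreal x)"
      using a u by (intro mult_left_mono conjugate_upper) auto
    finally show "ennreal (u * (c * x)) - g (ennreal u) \<le> ennreal c * conjugate g (ennreal x)" .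
  qed (use a in auto)
qed

lemma conjugate_eq_SUP_nnrat:
  assumes "star_shaped g" "0 \<le> v"
  shows "conjugate g (ennreal v) = (SUP i. ennreal (nnrat i * v) - g (ennreal (nnrat i)))"
proof (rule antisym)
  show "conjugate g (ennreal v) \<le> (SUP i. ennreal (nnrat i * v) - g (ennreal (nnrat i)))"
    using assms by (intro conjugate_least star_shaped_SUP_nnrat) auto
  show "(SUP i. ennreal (nnrat i * v) - g (ennreal (nnrat i))) \<le> conjugate g (ennreal v)"
    using assms by (intro SUP_least conjugate_upper) auto
qed

section \<open>Young functions and their biconjugates\<close>

definition young_function :: "(ennreal \<Rightarrow> ennreal) \<Rightarrow> bool" where
  "young_function g \<longleftrightarrow>
    (\<forall>x y a b. a + b = 1 \<longrightarrow> g (a * x + b * y) \<le> a * g x + b * g y) \<and>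
    (\<forall>x. g x \<le> Liminf (at x) g) \<and> g 0 = 0"

lemma young_function_convex:
  assumes "young_function g" "0 \<le> a" "0 \<le> b" "a + b = 1" "0 \<le> x" "0 \<le> y"
  shows "g (ennreal (a * x + b * y)) \<le> ennreal a * g (ennreal x) + ennreal b * g (ennreal y)"
proof -
  have "ennreal a + ennreal b = 1" using assms by (simp flip: ennreal_plus)
  then have "g (ennreal a * ennreal x + ennreal b * ennreal y)
      \<le> ennreal a * g (ennreal x) + ennreal b * g (ennreal y)"
    using assms(1) unfolding young_function_def by blast
  then show ?thesis using assms by (simp add: ennreal_mult)
qed

lemma young_function_star_shaped:
  assumes "young_function g" shows "star_shaped g"
  unfolding star_shaped_def
proof (intro allI impI)
  fix c x :: real assume "0 \<le> c \<and> c \<le> 1 \<and> 0 \<le> x"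
  moreover have "g 0 = 0" using assms by (simp add: young_function_def)
  ultimately show "g (ennreal (c * x)) \<le> ennreal c * g (ennreal x)"
    using young_function_convex[OF assms, of c "1 - c" x 0] by auto
qed

lemma star_shaped_mono:
  assumes "star_shaped g" "0 \<le> x" "x \<le> y" shows "g (ennreal x) \<le> g (ennreal y)"
proof (cases "y = 0")
  case False
  then have y: "0 < y" using assms by simp
  have "g (ennreal (x / y * y)) \<le> ennreal (x / y) * g (ennreal y)"
    using assms y unfolding star_shaped_def by (metis divide_le_eq_1_pos divide_nonneg_pos less_eq_real_def order_trans)
  also have "\<dots> \<le> 1 * g (ennreal y)" using assms y by (intro mult_right_mono) auto
  finally show ?thesis using y by simp
qed (use assms in auto)

text \<open>The right-hand side is the biconjugate at \<open>w\<close>, taken over rational slopes.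
  Comparing it with \<open>g\<close> at a smaller point \<open>w0\<close> leaves room to use a
  secant slope instead of a subgradient at \<open>w\<close>; lower semicontinuity closes the gap
  afterwards.\<close>

lemma young_function_below_biconjugate:
  assumes g: "young_function g" and w: "0 < w0" "w0 < w"
  shows "g (ennreal w0) \<le> (SUP i. ennreal (nnrat i * w) - conjugate g (ennreal (nnrat i)))"
    (is "_ \<le> ?S")
proof -
  note star = young_function_star_shaped[OF g]
  have S: "ennreal (v * w) - conjugate g (ennreal v) \<le> ?S" if "0 \<le> v" for v
    using star_shaped_SUP_nnrat[OF star_shaped_conjugate that, of w] w by simp
  \<comment> \<open>Strictly between the two points: \<open>w0 < m\<close> allows a secant to be
    formed, and \<open>m < w\<close> makes the supremum infinite in case \<open>g\<close> is
    infinite at \<open>m\<close>.\<close>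
  define m where "m = (w0 + w) / 2"
  have m: "w0 < m" "m < w" "0 < m" using w by (auto simp: m_def)
  show ?thesis
  proof (cases "g (ennreal m) = \<infinity>")
    case True
    \<comment> \<open>Beyond \<open>m\<close> the function is infinite, so the conjugate at
      \<open>v\<close> is at most \<open>v * m\<close>; the surplus \<open>v * (w - m)\<close> is
      unbounded in \<open>v\<close>.\<close>
    have bound: "ennreal (v * (w - m)) \<le> ?S" if v: "0 \<le> v" for v
    proof -
      have "conjugate g (ennreal v) \<le> ennreal (v * m)"
      proof (rule conjugate_least[OF v])
        fix u :: real assume u: "0 < u"
        show "ennreal (u * v) - g (ennreal u) \<le> ennreal (v * m)"
        proof (cases "u \<le> m")
          case True
          have "ennreal (u * v) - g (ennreal u) \<le> ennreal (u * v)" by (rule diff_le_self_ennreal)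
          also have "\<dots> \<le> ennreal (v * m)" using True v by (intro ennreal_leI) (simp add: mult.commute[of u] mult_left_mono)
          finally show ?thesis .
        next
          case False
          then have "g (ennreal u) = \<infinity>"
            using star_shaped_mono[OF star, of m u] True m by (simp add: top_unique)
          then show ?thesis by (simp add: ennreal_minus_top)
        qed
      qed
      then have "ennreal (v * w) - ennreal (v * m) \<le> ?S"
        using S[OF v] ennreal_minus_mono[OF order_refl] order_trans by blast
      then show ?thesis using v m by (simp add: ennreal_minus algebra_simps)
    qed
    have "?S = \<infinity>"
    proof (rule ccontr)
      assume "?S \<noteq> \<infinity>"
      then obtain s where s: "?S = ennreal s" "0 \<le> s" by (cases ?S) auto
      have "ennreal ((s + 1) / (w - m) * (w - m)) \<le> ?S" using s m by (intro bound) auto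
      then have "s + 1 \<le> s" using s m by (simp add: ennreal_le_iff)
      then show False by simp
    qed
    then show ?thesis by (metis infinity_ennreal_def top_greatest)
  next
    case False
    define pm where "pm = enn2real (g (ennreal m))"
    have pm: "g (ennreal m) = ennreal pm" "0 \<le> pm"
      using False by (simp_all add: pm_def less_top)
    have le: "g (ennreal w0) \<le> ennreal pm"
      using star_shaped_mono[OF star, of w0 m] w m(1) unfolding pm(1) by simp
    define p0 where "p0 = enn2real (g (ennreal w0))"
    have p0: "g (ennreal w0) = ennreal p0" "0 \<le> p0"
      using le_less_trans[OF le ennreal_less_top] by (simp_all add: p0_def)
    have p0_le: "p0 \<le> pm" using le pm(2) unfolding p0(1) by (simp add: ennreal_le_iff)
    define v where "v = (pm - p0) / (m - w0)"
    have v0: "0 \<le> v" using p0_le m by (simp add: v_def)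
    have vm: "v * (m - w0) = pm - p0" using m by (simp add: v_def)
    \<comment> \<open>The secant through \<open>w0\<close> and \<open>m\<close>, shifted by \<open>v * (m - w0)\<close>, is a supporting line.\<close>
    have line: "u * v + p0 \<le> v * m + p" if u: "0 \<le> u" and p: "g (ennreal u) = ennreal p" "0 \<le> p" for u p
    proof -
      \<comment> \<open>Outside the interval from \<open>w0\<close> to \<open>m\<close>, convexity
        puts \<open>g\<close> above the secant, which lies above its shifted copy. Inside,
        monotonicity gives \<open>p0 \<le> p\<close>, while the shifted line is at most
        \<open>p0\<close>.\<close>
      consider "u \<le> w0" | "w0 < u" "u \<le> m" | "m < u" by linarith
      then show ?thesis
      proof cases
        case 1
        define a b where "a = (m - w0) / (m - u)" and "b = (w0 - u) / (m - u)"
        have mu: "0 < m - u" using 1 m by simp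
        have ab: "0 \<le> a" "0 \<le> b" "a + b = 1" "a * (m - u) = m - w0" "b * (m - u) = w0 - u"
          using 1 m mu by (auto simp: a_def b_def simp flip: add_divide_distrib)
        have "(a * u + b * m) * (m - u) = (a * (m - u)) * u + (b * (m - u)) * m"
          by (simp add: algebra_simps)
        also have "\<dots> = w0 * (m - u)" unfolding ab(4,5) by (simp add: algebra_simps)
        finally have "(a * u + b * m) * (m - u) = w0 * (m - u)" .
        then have "a * u + b * m = w0" using mu by simp
        then have "ennreal p0 \<le> ennreal a * ennreal p + ennreal b * ennreal pm"
          using young_function_convex[OF g ab(1,2,3) u, of m] m p p0 pm by simp
        then have "p0 \<le> a * p + b * pm"
          using ab p pm by (simp flip: ennreal_mult ennreal_plus)
        then have "p0 * (m - u) \<le> (a * p + b * pm) * (m - u)" using mu by (intro mult_right_mono) auto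
        also have "\<dots> = (a * (m - u)) * p + (b * (m - u)) * pm" by (simp add: algebra_simps)
        also have "\<dots> = (m - w0) * p + (w0 - u) * pm" unfolding ab(4,5) ..
        finally have "(m - w0) * (p0 - p) \<le> (w0 - u) * (pm - p0)" by (simp add: algebra_simps)
        also have "\<dots> = (m - w0) * (v * (w0 - u))" by (simp flip: vm)
        finally have "p0 - p \<le> v * (w0 - u)" using m by simp
        also have "\<dots> \<le> v * (m - u)" using v0 m by (intro mult_left_mono) auto
        finally show ?thesis by (simp add: algebra_simps)
      next
        case 2
        have "p0 \<le> p" using star_shaped_mono[OF star, of w0 u] 2 w p p0 by simp
        moreover have "u * v \<le> v * m" using 2 v0 by (simp add: mult.commute[of u] mult_left_mono)
        ultimately show ?thesis by simp
      next
        case 3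
        define a b where "a = (u - m) / (u - w0)" and "b = (m - w0) / (u - w0)"
        have mu: "0 < u - w0" using 3 m by simp
        have ab: "0 \<le> a" "0 \<le> b" "a + b = 1" "a * (u - w0) = u - m" "b * (u - w0) = m - w0"
          using 3 m mu by (auto simp: a_def b_def simp flip: add_divide_distrib)
        have "(a * w0 + b * u) * (u - w0) = (a * (u - w0)) * w0 + (b * (u - w0)) * u"
          by (simp add: algebra_simps)
        also have "\<dots> = m * (u - w0)" unfolding ab(4,5) by (simp add: algebra_simps)
        finally have "(a * w0 + b * u) * (u - w0) = m * (u - w0)" .
        then have "a * w0 + b * u = m" using mu by simp
        then have "ennreal pm \<le> ennreal a * ennreal p0 + ennreal b * ennreal p"
          using young_function_convex[OF g ab(1,2,3), of w0 u] w u p p0 pm by simp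
        then have "pm \<le> a * p0 + b * p"
          using ab p p0 by (simp flip: ennreal_mult ennreal_plus)
        then have "pm * (u - w0) \<le> (a * p0 + b * p) * (u - w0)" using mu by (intro mult_right_mono) auto
        also have "\<dots> = (a * (u - w0)) * p0 + (b * (u - w0)) * p" by (simp add: algebra_simps)
        also have "\<dots> = (u - m) * p0 + (m - w0) * p" unfolding ab(4,5) ..
        finally have "(u - w0) * (pm - p0) \<le> (m - w0) * (p - p0)" by (simp add: algebra_simps)
        then have "(m - w0) * (v * (u - w0)) \<le> (m - w0) * (p - p0)" by (simp flip: vm add: ac_simps)
        then have "v * (u - w0) \<le> p - p0" using m by simp
        moreover have "v * (u - m) \<le> v * (u - w0)" using v0 m by (intro mult_left_mono) auto
        ultimately show ?thesis by (simp add: algebra_simps)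
      qed
    qed
    have "g 0 = 0" using g by (simp add: young_function_def)
    \<comment> \<open>Guarantees that the difference \<open>v * m - p0\<close> is nonnegative, so
      that passing to \<open>ennreal\<close> does not truncate it.\<close>
    then have p0m: "p0 \<le> v * m" using line[of 0 0] by simp
    have "conjugate g (ennreal v) \<le> ennreal (v * m - p0)"
    proof (rule conjugate_least[OF v0])
      fix u :: real assume u: "0 < u"
      show "ennreal (u * v) - g (ennreal u) \<le> ennreal (v * m - p0)"
      proof (cases "g (ennreal u)")
        case (real p)
        then show ?thesis using line[of u p] u by (simp add: ennreal_minus ennreal_leI)
      next
        case top
        then show ?thesis by (simp add: ennreal_minus_top)
      qed
    qed
    then have "ennreal (v * w) - ennreal (v * m - p0) \<le> ?S"
      using S[OF v0] ennreal_minus_mono[OF order_refl] order_trans by blast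
    then have "ennreal (v * w - (v * m - p0)) \<le> ?S" using p0m by (simp add: ennreal_minus)
    moreover have "v * m \<le> v * w" using m v0 by (intro mult_left_mono) auto
    then have "p0 \<le> v * w - (v * m - p0)" by linarith
    then have "g (ennreal w0) \<le> ennreal (v * w - (v * m - p0))" unfolding p0(1) by (rule ennreal_leI)
    ultimately show ?thesis by (rule order_trans[rotated])
  qed
qed

text \<open>The Fenchel-Moreau theorem for finite arguments. One inequality is Young's; for the
  other, all points to the left of \<open>w\<close> are bounded by the supremum at \<open>w\<close>,
  and lower semicontinuity transfers the bound to \<open>w\<close>.\<close>

lemma young_function_biconjugate:
  assumes g: "young_function g" and w: "0 \<le> w"
  shows "g (ennreal w) = (SUP i. ennreal (nnrat i * w) - conjugate g (ennreal (nnrat i)))"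
    (is "_ = ?S")
proof (rule antisym)
  have "ennreal (nnrat i * w) - conjugate g (ennreal (nnrat i)) \<le> g (ennreal w)" for i
    using Young_inequality[OF w nnrat_nonneg[of i], of g]
    by (simp add: ennreal_minus_le_iff ac_simps)
  then show "?S \<le> g (ennreal w)" by (intro SUP_least) auto
  show "g (ennreal w) \<le> ?S"
  proof (cases "w = 0")
    case True
    then show ?thesis using g by (simp add: young_function_def)
  next
    case False
    then have w0: "0 < ennreal w" using w by (simp add: ennreal_less_zero_iff)
    show ?thesis
    proof (rule ccontr)
      assume "\<not> g (ennreal w) \<le> ?S"
      moreover have "g (ennreal w) \<le> Liminf (at (ennreal w)) g"
        using g by (simp add: young_function_def)
      ultimately have "?S < Liminf (at (ennreal w)) g" by simp
      then have "\<forall>\<^sub>F x in at (ennreal w). ?S < g x" by (rule less_LiminfD)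
      then have "\<forall>\<^sub>F x in at_left (ennreal w). ?S < g x" by (simp add: eventually_at_split)
      then obtain b where b: "b < ennreal w" "\<And>y. b < y \<Longrightarrow> y < ennreal w \<Longrightarrow> ?S < g y"
        unfolding eventually_at_left[OF w0] by metis
      obtain y where y: "b < y" "y < ennreal w" using dense[OF b(1)] by blast
      then obtain y' where y': "y = ennreal y'" "0 \<le> y'" by (cases y) auto
      have "0 < ennreal y'" "ennreal y' < ennreal w" using y y' le_less_trans[of 0 b y] by auto
      then have "0 < y'" "y' < w" using y' by (simp_all add: ennreal_less_iff)
      then have "g y \<le> ?S" using young_function_below_biconjugate[OF g] y' by simp
      then show False using b(2)[OF y] by simp
    qed
  qed
qed

section \<open>Modulars of a conjugate pair\<close>

text \<open>The assumptions are symmetric in \<open>\<Phi>\<close> and \<open>\<Psi>\<close>, so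
  that each fact about one function is available for the other through
  \<open>conjugate_pair_sym\<close>. Finite arguments suffice because modulars are taken of
  real-valued functions.\<close>

locale conjugate_pair = sigma_finite_measure M for M :: "'a measure" +
  fixes \<Phi> \<Psi> :: "'a \<Rightarrow> ennreal \<Rightarrow> ennreal"
  assumes left_eq: "\<And>t u. 0 \<le> u \<Longrightarrow>
      \<Phi> t (ennreal u) = (SUP i. ennreal (nnrat i * u) - \<Psi> t (ennreal (nnrat i)))"
    and right_eq: "\<And>t u. 0 \<le> u \<Longrightarrow>
      \<Psi> t (ennreal u) = (SUP i. ennreal (nnrat i * u) - \<Phi> t (ennreal (nnrat i)))"
    and Young: "\<And>t u v. 0 \<le> u \<Longrightarrow> 0 \<le> v \<Longrightarrow> ennreal (u * v) \<le> \<Phi> t (ennreal u) + \<Psi> t (ennreal v)"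
    and star: "\<And>t. star_shaped (\<Phi> t)" "\<And>t. star_shaped (\<Psi> t)"
    and meas_nnrat: "\<And>i. (\<lambda>t. \<Phi> t (ennreal (nnrat i))) \<in> borel_measurable M"
      "\<And>i. (\<lambda>t. \<Psi> t (ennreal (nnrat i))) \<in> borel_measurable M"
begin

lemma conjugate_pair_sym: "conjugate_pair M \<Psi> \<Phi>"
proof unfold_locales
  show "ennreal (u * v) \<le> \<Psi> t (ennreal u) + \<Phi> t (ennreal v)" if "0 \<le> u" "0 \<le> v" for t u v
    using Young[OF that(2,1), of t] by (simp add: ac_simps)
qed (rule left_eq right_eq star meas_nnrat; assumption)+

lemma zero [simp]: "\<Phi> t 0 = 0"
  using left_eq[of 0 t] by (simp add: SUP_constant)

lemma mono: "0 \<le> x \<Longrightarrow> x \<le> y \<Longrightarrow> \<Phi> t (ennreal x) \<le> \<Phi> t (ennreal y)"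
  using star_shaped_mono star by blast

lemma scale: "0 \<le> c \<Longrightarrow> c \<le> 1 \<Longrightarrow> 0 \<le> x \<Longrightarrow> \<Phi> t (ennreal (c * x)) \<le> ennreal c * \<Phi> t (ennreal x)"
  using star unfolding star_shaped_def by blast

text \<open>Measurability of \<open>\<Phi> t u\<close> in \<open>t\<close> for fixed
  \<open>u\<close> does not by itself give that of the composition; the countable supremum does,
  since its terms depend on \<open>u t\<close> only through a product.\<close>

lemma measurable_comp [measurable]:
  assumes [measurable]: "u \<in> borel_measurable M"
  shows "(\<lambda>t. \<Phi> t (ennreal \<bar>u t\<bar>)) \<in> borel_measurable M"
proof -
  note [measurable] = meas_nnrat
  have "(\<lambda>t. SUP i. ennreal (nnrat i * \<bar>u t\<bar>) - \<Psi> t (ennreal (nnrat i))) \<in> borel_measurable M"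
    by measurable
  then show ?thesis by (simp add: left_eq)
qed

lemma modular_mono:
  assumes "AE t in M. \<bar>u t\<bar> \<le> \<bar>w t\<bar>" shows "modular M \<Phi> u \<le> modular M \<Phi> w"
  unfolding modular_def using assms by (intro nn_integral_mono_AE) (auto elim!: eventually_mono intro: mono)

lemma modular_scale:
  assumes [measurable]: "u \<in> borel_measurable M" and c: "0 \<le> c" "c \<le> 1"
  shows "modular M \<Phi> (\<lambda>t. c * u t) \<le> ennreal c * modular M \<Phi> u"
proof -
  have "modular M \<Phi> (\<lambda>t. c * u t) \<le> (\<integral>\<^sup>+ t. ennreal c * \<Phi> t (ennreal \<bar>u t\<bar>) \<partial>M)"
    unfolding modular_def using c by (intro nn_integral_mono) (auto simp: abs_mult intro: scale)
  also have "\<dots> = ennreal c * modular M \<Phi> u"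
    unfolding modular_def by (rule nn_integral_cmult) measurable
  finally show ?thesis .
qed

text \<open>Meant for functions glued from two pieces and for pointwise maxima: at each point one of
  the two summands already dominates, so monotonicity is enough.\<close>

lemma modular_split_le:
  assumes [measurable]: "u \<in> borel_measurable M" "w \<in> borel_measurable M"
    and le: "AE t in M. \<bar>x t\<bar> \<le> \<bar>u t\<bar> \<or> \<bar>x t\<bar> \<le> \<bar>w t\<bar>"
  shows "modular M \<Phi> x \<le> modular M \<Phi> u + modular M \<Phi> w"
proof -
  have *: "\<Phi> t (ennreal \<bar>x t\<bar>) \<le> \<Phi> t (ennreal \<bar>u t\<bar>) + \<Phi> t (ennreal \<bar>w t\<bar>)"
    if "\<bar>x t\<bar> \<le> \<bar>u t\<bar> \<or> \<bar>x t\<bar> \<le> \<bar>w t\<bar>" for t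
    using that
  proof
    assume "\<bar>x t\<bar> \<le> \<bar>u t\<bar>"
    then show ?thesis by (intro order_trans[OF mono[of "\<bar>x t\<bar>" "\<bar>u t\<bar>"]]) auto
  next
    assume "\<bar>x t\<bar> \<le> \<bar>w t\<bar>"
    then show ?thesis by (intro order_trans[OF mono[of "\<bar>x t\<bar>" "\<bar>w t\<bar>"]]) auto
  qed
  have "modular M \<Phi> x \<le> (\<integral>\<^sup>+ t. \<Phi> t (ennreal \<bar>u t\<bar>) + \<Phi> t (ennreal \<bar>w t\<bar>) \<partial>M)"
    unfolding modular_def using le * by (intro nn_integral_mono_AE) (auto elim!: eventually_mono)
  also have "\<dots> = modular M \<Phi> u + modular M \<Phi> w"
    unfolding modular_def by (intro nn_integral_add) measurable
  finally show ?thesis .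
qed

lemma modular_tendsto_0:
  assumes [measurable]: "u \<in> borel_measurable M" "\<And>n. A n \<in> sets M"
    and fin: "modular M \<Phi> u < \<infinity>"
    and A: "AE t in M. \<forall>\<^sub>F n in sequentially. t \<notin> A n"
  shows "(\<lambda>n. modular M \<Phi> (\<lambda>t. indicator (A n) t * u t)) \<longlonglongrightarrow> 0"
proof -
  have "(\<lambda>n. \<integral>\<^sup>+ t. \<Phi> t (ennreal \<bar>indicator (A n) t * u t\<bar>) \<partial>M) \<longlonglongrightarrow> (\<integral>\<^sup>+ t. 0 \<partial>M)"
  proof (rule nn_integral_dominated_convergence[where w = "\<lambda>t. \<Phi> t (ennreal \<bar>u t\<bar>)"])
    show "AE t in M. \<Phi> t (ennreal \<bar>indicator (A n) t * u t\<bar>) \<le> \<Phi> t (ennreal \<bar>u t\<bar>)" for n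
      by (rule AE_I2) (auto simp: indicator_def)
    show "(\<integral>\<^sup>+ t. \<Phi> t (ennreal \<bar>u t\<bar>) \<partial>M) < \<infinity>" using fin by (simp add: modular_def)
    show "AE t in M. (\<lambda>n. \<Phi> t (ennreal \<bar>indicator (A n) t * u t\<bar>)) \<longlonglongrightarrow> 0"
      using A by eventually_elim (auto intro!: tendsto_eventually elim!: eventually_mono)
  qed measurable
  then show ?thesis by (simp add: modular_def)
qed

lemma Young_integral:
  assumes [measurable]: "u \<in> borel_measurable M" "v \<in> borel_measurable M"
  shows "(\<integral>\<^sup>+ t. ennreal \<bar>u t * v t\<bar> \<partial>M) \<le> modular M \<Phi> u + modular M \<Psi> v"
proof -
  interpret dual: conjugate_pair M \<Psi> \<Phi> by (rule conjugate_pair_sym)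
  have "(\<integral>\<^sup>+ t. ennreal \<bar>u t * v t\<bar> \<partial>M)
      \<le> (\<integral>\<^sup>+ t. \<Phi> t (ennreal \<bar>u t\<bar>) + \<Psi> t (ennreal \<bar>v t\<bar>) \<partial>M)"
    by (intro nn_integral_mono) (auto simp: abs_mult intro: Young)
  also have "\<dots> = modular M \<Phi> u + modular M \<Psi> v"
    unfolding modular_def by (intro nn_integral_add) measurable
  finally show ?thesis .
qed

text \<open>A measurable selection: at each point of \<open>F\<close>, a best choice among 0 and the
  first \<open>n\<close> rationals, subject to the cap \<open>K\<close>. The cap gives a finite
  modular when \<open>F\<close> has finite measure, and
  \<open>\<Phi> t (u t) \<le> u t * \<bar>v t\<bar>\<close> makes the truncated difference a genuine
  one.\<close>

lemma finite_maximizer: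
  assumes [measurable]: "v \<in> borel_measurable M" "F \<in> sets M"
  shows "\<exists>u\<in>borel_measurable M. \<forall>t. 0 \<le> u t \<and> (t \<notin> F \<longrightarrow> u t = 0) \<and>
     \<Phi> t (ennreal (u t)) \<le> of_nat K \<and> \<Phi> t (ennreal (u t)) \<le> ennreal (u t * \<bar>v t\<bar>) \<and>
     (\<forall>i<n. t \<in> F \<and> \<Phi> t (ennreal (nnrat i)) \<le> of_nat K \<longrightarrow>
        ennreal (nnrat i * \<bar>v t\<bar>) - \<Phi> t (ennreal (nnrat i))
          \<le> ennreal (u t * \<bar>v t\<bar>) - \<Phi> t (ennreal (u t)))"
proof (induction n)
  case 0
  show ?case by (intro bexI[of _ "\<lambda>t. 0"]) auto
next
  case (Suc n)
  then obtain u where u [measurable]: "u \<in> borel_measurable M" and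
    pos: "\<And>t. 0 \<le> u t" and
    P: "\<And>t. t \<notin> F \<Longrightarrow> u t = 0" "\<And>t. \<Phi> t (ennreal (u t)) \<le> of_nat K"
     "\<And>t. \<Phi> t (ennreal (u t)) \<le> ennreal (u t * \<bar>v t\<bar>)"
     "\<And>t i. i < n \<Longrightarrow> t \<in> F \<Longrightarrow> \<Phi> t (ennreal (nnrat i)) \<le> of_nat K \<Longrightarrow>
        ennreal (nnrat i * \<bar>v t\<bar>) - \<Phi> t (ennreal (nnrat i))
          \<le> ennreal (u t * \<bar>v t\<bar>) - \<Phi> t (ennreal (u t))" by metis
  note [measurable] = meas_nnrat
  have "(\<lambda>t. \<Phi> t (ennreal \<bar>u t\<bar>)) \<in> borel_measurable M" by measurable
  then have [measurable]: "(\<lambda>t. \<Phi> t (ennreal (u t))) \<in> borel_measurable M" using pos by simp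
  \<comment> \<open>The set where the new candidate \<open>nnrat n\<close> is admissible and
    strictly better than the previous choice; the choice is changed exactly there.\<close>
  define D where "D = {t \<in> space M. t \<in> F \<and> \<Phi> t (ennreal (nnrat n)) \<le> of_nat K \<and>
     ennreal (u t * \<bar>v t\<bar>) - \<Phi> t (ennreal (u t))
       < ennreal (nnrat n * \<bar>v t\<bar>) - \<Phi> t (ennreal (nnrat n))}"
  have [measurable]: "D \<in> sets M" unfolding D_def by measurable
  have FM: "F \<subseteq> space M" using assms(2) by (rule sets.sets_into_space)
  show ?case
  proof (intro bexI[of _ "\<lambda>t. if t \<in> D then nnrat n else u t"] allI conjI impI)
    fix t
    show "\<Phi> t (ennreal (if t \<in> D then nnrat n else u t)) \<le> ennreal ((if t \<in> D then nnrat n else u t) * \<bar>v t\<bar>)"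
    proof (cases "t \<in> D")
      case True
      then have "0 < ennreal (nnrat n * \<bar>v t\<bar>) - \<Phi> t (ennreal (nnrat n))"
        by (auto simp: D_def intro: le_less_trans)
      then show ?thesis using True
        by (metis diff_eq_0_iff_ennreal ennreal_less_top less_irrefl not_less order_less_imp_le)
    qed (use P in auto)
    fix i assume i: "i < Suc n" and t: "t \<in> F \<and> \<Phi> t (ennreal (nnrat i)) \<le> of_nat K"
    show "ennreal (nnrat i * \<bar>v t\<bar>) - \<Phi> t (ennreal (nnrat i))
      \<le> ennreal ((if t \<in> D then nnrat n else u t) * \<bar>v t\<bar>) - \<Phi> t (ennreal (if t \<in> D then nnrat n else u t))"
    proof (cases "i = n")
      case True
      then show ?thesis using t FM by (auto simp: D_def not_less)
    next
      case False
      then have "ennreal (nnrat i * \<bar>v t\<bar>) - \<Phi> t (ennreal (nnrat i))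
          \<le> ennreal (u t * \<bar>v t\<bar>) - \<Phi> t (ennreal (u t))" using i t by (intro P) auto
      then show ?thesis by (auto simp: D_def intro: order_trans less_imp_le)
    qed
  qed (use P pos in \<open>auto simp: D_def\<close>)
qed

text \<open>Since \<open>\<Psi>\<close> is a countable supremum, \<open>modular M \<Psi> v\<close> is the supremum of
  \<open>\<integral>u\<bar>v\<bar> - modular M \<Phi> u\<close> over the finite maximizers above, by monotone convergence.\<close>

lemma modular_conjugate_le:
  assumes [measurable]: "v \<in> borel_measurable M"
    and bound: "\<And>u. u \<in> borel_measurable M \<Longrightarrow> (\<And>t. 0 \<le> u t) \<Longrightarrow> modular M \<Phi> u < \<infinity> \<Longrightarrow>
      (\<integral>\<^sup>+ t. ennreal (u t * \<bar>v t\<bar>) \<partial>M) \<le> modular M \<Phi> u + C"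
  shows "modular M \<Psi> v \<le> C"
proof -
  obtain F :: "nat \<Rightarrow> 'a set" where F: "range F \<subseteq> sets M" "(\<Union>i. F i) = space M"
    "\<And>i. emeasure M (F i) \<noteq> \<infinity>" "incseq F" using sigma_finite_incseq by metis
  have [measurable]: "F n \<in> sets M" for n using F(1) by auto
  note [measurable] = meas_nnrat
  define T where "T i t = ennreal (nnrat i * \<bar>v t\<bar>) - \<Phi> t (ennreal (nnrat i))" for i t
  have [measurable]: "T i \<in> borel_measurable M" for i unfolding T_def by measurable
  \<comment> \<open>The points at which candidate \<open>i\<close> is admissible at stage
    \<open>n\<close>, with both the exhausting set and the cap on \<open>\<Phi>\<close> growing in
    \<open>n\<close>.\<close>
  define G where "G n i = {t \<in> space M. t \<in> F n \<and> \<Phi> t (ennreal (nnrat i)) \<le> of_nat n}" for n i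
  have [measurable]: "G n i \<in> sets M" for n i unfolding G_def by measurable
  \<comment> \<open>Stage \<open>n\<close> of the supremum for \<open>\<Psi>\<close>: only
    admissible candidates with index below \<open>n\<close> count. It is what the finite maximizer
    reaches, and it increases to \<open>\<Psi> t \<bar>v t\<bar>\<close>.\<close>
  define H where "H n t = (SUP i\<in>{..<n}. indicator (G n i) t * T i t)" for n t
  have [measurable]: "H n \<in> borel_measurable M" for n unfolding H_def by measurable
  have HC: "(\<integral>\<^sup>+ t. H n t \<partial>M) \<le> C" for n
  proof -
    obtain u where u [measurable]: "u \<in> borel_measurable M" and
      pos: "\<And>t. 0 \<le> u t" and
      P: "\<And>t. t \<notin> F n \<Longrightarrow> u t = 0" "\<And>t. \<Phi> t (ennreal (u t)) \<le> of_nat n"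
       "\<And>t. \<Phi> t (ennreal (u t)) \<le> ennreal (u t * \<bar>v t\<bar>)"
       "\<And>t i. i < n \<Longrightarrow> t \<in> F n \<Longrightarrow> \<Phi> t (ennreal (nnrat i)) \<le> of_nat n \<Longrightarrow>
          T i t \<le> ennreal (u t * \<bar>v t\<bar>) - \<Phi> t (ennreal (u t))"
      using finite_maximizer[of v "F n" n n] unfolding T_def by auto
    have I: "modular M \<Phi> u \<le> (\<integral>\<^sup>+ t. of_nat n * indicator (F n) t \<partial>M)"
      unfolding modular_def using P pos by (intro nn_integral_mono) (auto simp: indicator_def)
    also have "\<dots> = of_nat n * emeasure M (F n)" by (simp add: nn_integral_cmult_indicator)
    also have "\<dots> < \<infinity>" using F(3)[of n] by (simp add: ennreal_mult_less_top less_top of_nat_less_top)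
    finally have fin: "modular M \<Phi> u < \<infinity>" .
    have meas: "(\<lambda>t. \<Phi> t (ennreal \<bar>u t\<bar>)) \<in> borel_measurable M" by measurable
    have "H n t + \<Phi> t (ennreal \<bar>u t\<bar>) \<le> ennreal (u t * \<bar>v t\<bar>)" for t
    proof -
      have "H n t \<le> ennreal (u t * \<bar>v t\<bar>) - \<Phi> t (ennreal (u t))"
        unfolding H_def using P(4) by (intro SUP_least) (auto simp: G_def indicator_def)
      then have "H n t + \<Phi> t (ennreal (u t)) \<le> ennreal (u t * \<bar>v t\<bar>) - \<Phi> t (ennreal (u t)) + \<Phi> t (ennreal (u t))"
        by (rule add_right_mono)
      also have "\<dots> = ennreal (u t * \<bar>v t\<bar>)" using P(3) by (rule diff_add_cancel_ennreal)
      finally show ?thesis using pos by simp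
    qed
    then have "(\<integral>\<^sup>+ t. H n t + \<Phi> t (ennreal \<bar>u t\<bar>) \<partial>M) \<le> (\<integral>\<^sup>+ t. ennreal (u t * \<bar>v t\<bar>) \<partial>M)"
      by (intro nn_integral_mono)
    also have "\<dots> \<le> modular M \<Phi> u + C" using u pos fin by (rule bound)
    finally have "modular M \<Phi> u + (\<integral>\<^sup>+ t. H n t \<partial>M) \<le> modular M \<Phi> u + C"
      using meas by (subst (asm) nn_integral_add) (auto simp: modular_def add.commute)
    \<comment> \<open>Finiteness of \<open>modular M \<Phi> u\<close> is what permits cancelling it
      from both sides.\<close>
    then show ?thesis using fin by (auto simp: ennreal_add_left_cancel_le)
  qed
  have Hinc: "incseq H"
  proof (intro incseq_SucI le_funI)
    fix n t
    have "F n \<subseteq> F (Suc n)" using F(4) by (auto dest: incseq_SucD)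
    moreover have "(of_nat n :: ennreal) \<le> of_nat (Suc n)" by (rule of_nat_mono) simp
    ultimately have "G n i \<subseteq> G (Suc n) i" for i
      unfolding G_def using order_trans by blast
    then show "H n t \<le> H (Suc n) t" unfolding H_def
      by (intro SUP_subset_mono mult_right_mono) (auto simp: indicator_def)
  qed
  have HT: "(SUP n. H n t) = \<Psi> t (ennreal \<bar>v t\<bar>)" if t: "t \<in> space M" for t
  proof (rule antisym)
    have *: "\<Psi> t (ennreal \<bar>v t\<bar>) = (SUP i. T i t)" by (simp add: right_eq T_def)
    have "H n t \<le> (SUP i. T i t)" for n unfolding H_def
      by (intro SUP_least) (auto simp: indicator_def intro: SUP_upper)
    then show "(SUP n. H n t) \<le> \<Psi> t (ennreal \<bar>v t\<bar>)" unfolding * by (rule SUP_least)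
    have "T i t \<le> (SUP n. H n t)" for i
    proof (cases "\<Phi> t (ennreal (nnrat i)) = \<infinity>")
      case True
      then show ?thesis by (simp add: T_def ennreal_minus_top)
    next
      case False
      then obtain k where k: "\<Phi> t (ennreal (nnrat i)) \<le> of_nat k"
        using ennreal_Ex_less_of_nat[of "\<Phi> t (ennreal (nnrat i))"]
        by (auto simp: less_top intro: less_imp_le)
      obtain l where l: "t \<in> F l" using t F(2) by auto
      \<comment> \<open>Large enough for the cap (\<open>k\<close>), for the exhausting set
        (\<open>l\<close>) and for \<open>i\<close> to be among the indices below
        \<open>n\<close>.\<close>
      define n where "n = max (max k l) (Suc i)"
      have "F l \<subseteq> F n" using F(4) by (auto simp: incseq_def n_def)
      moreover have "\<Phi> t (ennreal (nnrat i)) \<le> of_nat n"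
        using k by (rule order_trans) (simp add: n_def)
      ultimately have "t \<in> G n i" using l t by (auto simp: G_def)
      then have "T i t \<le> H n t" unfolding H_def
        by (intro SUP_upper2[of i]) (auto simp: n_def)
      also have "\<dots> \<le> (SUP n. H n t)" by (rule SUP_upper) simp
      finally show ?thesis .
    qed
    then show "\<Psi> t (ennreal \<bar>v t\<bar>) \<le> (SUP n. H n t)" unfolding * by (rule SUP_least)
  qed
  have "modular M \<Psi> v = (\<integral>\<^sup>+ t. (SUP n. H n t) \<partial>M)"
    unfolding modular_def using HT by (intro nn_integral_cong) auto
  also have "\<dots> = (SUP n. \<integral>\<^sup>+ t. H n t \<partial>M)"
    using Hinc by (intro nn_integral_monotone_convergence_SUP) auto
  also have "\<dots> \<le> C" using HC by (rule SUP_least)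
  finally show ?thesis .
qed

end

section \<open>Orlicz spaces and bounded functionals\<close>

text \<open>At \<open>a = 0\<close> the quotient is infinite unless \<open>x = 0\<close>, so both
  sides say \<open>x = 0\<close>. Vanishing norms in the denominators of
  \<open>functional_norm\<close> thus need no separate treatment.\<close>

lemma ennreal_divide_le_iff_mult:
  fixes x a c :: real
  assumes "0 \<le> x" "0 \<le> a" "0 \<le> c"
  shows "ennreal x / ennreal a \<le> ennreal c \<longleftrightarrow> x \<le> c * a"
proof (cases "a = 0")
  case True
  then show ?thesis using assms by (auto simp: top_unique)
next
  case False
  then have "ennreal x / ennreal a = ennreal (x / a)" using assms by (simp add: divide_ennreal)
  then show ?thesis using assms False by (simp add: divide_le_eq)
qed

section \<open>The Orlicz space as a solid vector space, and its pairing with the dual one\<close>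

context conjugate_pair
begin

lemma space_measurable: "u \<in> orlicz_space M \<Phi> \<Longrightarrow> u \<in> borel_measurable M"
  by (simp add: orlicz_space_def)

lemma space_cases:
  assumes "u \<in> orlicz_space M \<Phi>"
  obtains l where "0 < l" "modular M \<Phi> (\<lambda>t. l * u t) < \<infinity>"
  using assms by (auto simp: orlicz_space_def)

lemma spaceI:
  assumes "u \<in> borel_measurable M" "modular M \<Phi> u < \<infinity>" shows "u \<in> orlicz_space M \<Phi>"
  using assms unfolding orlicz_space_def by (auto intro!: exI[of _ 1])

lemma space_solid:
  assumes u: "u \<in> orlicz_space M \<Phi>" and w: "w \<in> borel_measurable M"
    and le: "AE t in M. \<bar>w t\<bar> \<le> \<bar>u t\<bar>"
  shows "w \<in> orlicz_space M \<Phi>"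
proof -
  obtain l where l: "0 < l" "modular M \<Phi> (\<lambda>t. l * u t) < \<infinity>" using u by (rule space_cases)
  have "modular M \<Phi> (\<lambda>t. l * w t) \<le> modular M \<Phi> (\<lambda>t. l * u t)"
    using le l by (intro modular_mono) (auto simp: abs_mult elim!: eventually_mono)
  then show ?thesis using l w le_less_trans unfolding orlicz_space_def by blast
qed

lemma space_scale:
  assumes u: "u \<in> orlicz_space M \<Phi>" shows "(\<lambda>t. c * u t) \<in> orlicz_space M \<Phi>"
proof -
  note [measurable] = space_measurable[OF u]
  obtain l where l: "0 < l" "modular M \<Phi> (\<lambda>t. l * u t) < \<infinity>" using u by (rule space_cases)
  \<comment> \<open>Dividing by \<open>\<bar>c\<bar> + 1\<close> rather than
    \<open>\<bar>c\<bar>\<close> also covers \<open>c = 0\<close>.\<close>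
  have "modular M \<Phi> (\<lambda>t. l / (\<bar>c\<bar> + 1) * (c * u t)) \<le> modular M \<Phi> (\<lambda>t. l * u t)"
  proof (rule modular_mono, rule AE_I2)
    fix t
    have "\<bar>c\<bar> / (\<bar>c\<bar> + 1) * (l * \<bar>u t\<bar>) \<le> 1 * (l * \<bar>u t\<bar>)"
      using l by (intro mult_right_mono) auto
    then show "\<bar>l / (\<bar>c\<bar> + 1) * (c * u t)\<bar> \<le> \<bar>l * u t\<bar>"
      using l by (simp add: abs_mult ac_simps)
  qed
  moreover have "0 < l / (\<bar>c\<bar> + 1)" using l by (simp add: add_nonneg_pos)
  ultimately show ?thesis
    using l(2) le_less_trans unfolding orlicz_space_def by (auto intro!: exI[of _ "l / (\<bar>c\<bar> + 1)"])
qed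

lemma space_add:
  assumes u: "u \<in> orlicz_space M \<Phi>" and w: "w \<in> orlicz_space M \<Phi>"
  shows "(\<lambda>t. u t + w t) \<in> orlicz_space M \<Phi>"
proof -
  note [measurable] = space_measurable[OF u] space_measurable[OF w]
  obtain l where l: "0 < l" "modular M \<Phi> (\<lambda>t. l * u t) < \<infinity>" using u by (rule space_cases)
  obtain k where k: "0 < k" "modular M \<Phi> (\<lambda>t. k * w t) < \<infinity>" using w by (rule space_cases)
  \<comment> \<open>The factor 1/2 absorbs the 2 in the bound of
    \<open>\<bar>u t + w t\<bar>\<close> by twice the larger absolute value.\<close>
  define m where "m = min l k / 2"
  have m: "0 < m" "2 * m \<le> l" "2 * m \<le> k" using l k by (auto simp: m_def)
  have "modular M \<Phi> (\<lambda>t. m * (u t + w t)) \<le> modular M \<Phi> (\<lambda>t. l * u t) + modular M \<Phi> (\<lambda>t. k * w t)"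
  proof (rule modular_split_le)
    show "AE t in M. \<bar>m * (u t + w t)\<bar> \<le> \<bar>l * u t\<bar> \<or> \<bar>m * (u t + w t)\<bar> \<le> \<bar>k * w t\<bar>"
    proof (rule AE_I2)
      fix t
      have le: "2 * m * \<bar>u t\<bar> \<le> l * \<bar>u t\<bar>" "2 * m * \<bar>w t\<bar> \<le> k * \<bar>w t\<bar>"
        using m by (auto intro: mult_right_mono)
      have abs: "\<bar>m * (u t + w t)\<bar> = m * \<bar>u t + w t\<bar>" "\<bar>l * u t\<bar> = l * \<bar>u t\<bar>" "\<bar>k * w t\<bar> = k * \<bar>w t\<bar>"
        using m l k by (auto simp: abs_mult)
      have "m * \<bar>u t + w t\<bar> \<le> m * (2 * max \<bar>u t\<bar> \<bar>w t\<bar>)" using m by (intro mult_left_mono) auto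
      then have "m * \<bar>u t + w t\<bar> \<le> 2 * m * max \<bar>u t\<bar> \<bar>w t\<bar>" by (simp add: ac_simps)
      with le show "\<bar>m * (u t + w t)\<bar> \<le> \<bar>l * u t\<bar> \<or> \<bar>m * (u t + w t)\<bar> \<le> \<bar>k * w t\<bar>"
        unfolding abs max_def by (auto split: if_splits)
    qed
  qed measurable
  also have "\<dots> < \<infinity>" using l k by simp
  finally have "modular M \<Phi> (\<lambda>t. m * (u t + w t)) < \<infinity>" .
  then show ?thesis using m(1) unfolding orlicz_space_def by auto
qed

lemma space_diff:
  assumes "u \<in> orlicz_space M \<Phi>" "w \<in> orlicz_space M \<Phi>"
  shows "(\<lambda>t. u t - w t) \<in> orlicz_space M \<Phi>"
  using space_add[OF assms(1) space_scale[OF assms(2), of "- 1"]] by simp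

lemma space_zero [simp]: "(\<lambda>t. 0) \<in> orlicz_space M \<Phi>"
  by (rule spaceI) (auto simp: modular_def)

lemma space_if:
  assumes "A \<in> sets M" "u \<in> orlicz_space M \<Phi>" "w \<in> orlicz_space M \<Phi>"
  shows "(\<lambda>t. if t \<in> A then u t else w t) \<in> orlicz_space M \<Phi>"
proof (rule space_solid[OF space_add])
  note [measurable] = assms(1) space_measurable[OF assms(2)] space_measurable[OF assms(3)]
  show "(\<lambda>t. if t \<in> A then u t else w t) \<in> borel_measurable M" by measurable
  show "(\<lambda>t. \<bar>u t\<bar>) \<in> orlicz_space M \<Phi>" "(\<lambda>t. \<bar>w t\<bar>) \<in> orlicz_space M \<Phi>"
    by (rule space_solid[OF assms(2)] space_solid[OF assms(3)]; simp)+
qed auto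

lemma integrable_prod:
  assumes u: "u \<in> orlicz_space M \<Phi>" and v: "v \<in> orlicz_space M \<Psi>"
  shows "integrable M (\<lambda>t. u t * v t)"
proof -
  interpret dual: conjugate_pair M \<Psi> \<Phi> by (rule conjugate_pair_sym)
  note [measurable] = space_measurable[OF u] dual.space_measurable[OF v]
  obtain l where l: "0 < l" "modular M \<Phi> (\<lambda>t. l * u t) < \<infinity>" using u by (rule space_cases)
  obtain k where k: "0 < k" "modular M \<Psi> (\<lambda>t. k * v t) < \<infinity>" using v by (rule dual.space_cases)
  have "(\<integral>\<^sup>+ t. ennreal \<bar>(l * u t) * (k * v t)\<bar> \<partial>M)
      \<le> modular M \<Phi> (\<lambda>t. l * u t) + modular M \<Psi> (\<lambda>t. k * v t)"
    by (rule Young_integral) measurable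
  also have "\<dots> < \<infinity>" using l k by simp
  finally have "integrable M (\<lambda>t. (l * u t) * (k * v t))"
    by (intro integrableI_bounded) (auto simp: real_norm_def)
  then have "integrable M (\<lambda>t. 1 / (l * k) * ((l * u t) * (k * v t)))" by (rule integrable_mult_right)
  then show ?thesis using l k by simp
qed

end

text \<open>The Orlicz norm is defined through \<open>complementary \<Phi>\<close>, so the symmetry
  of the pair ends here; facts about the dual side come from interpreting
  \<open>conjugate_pair M \<Psi> \<Phi>\<close>.\<close>

locale musielak_pair = conjugate_pair M \<Phi> "complementary \<Phi>"
  for M :: "'a measure" and \<Phi> :: "'a \<Rightarrow> ennreal \<Rightarrow> ennreal"
begin

abbreviation "\<Psi> \<equiv> complementary \<Phi>"

lemma dual_pair: "conjugate_pair M \<Psi> \<Phi>"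
  by (rule conjugate_pair_sym)

lemma orlicz_norm_upper:
  assumes "v \<in> borel_measurable M" "modular M \<Psi> v \<le> 1"
  shows "ennreal \<bar>\<integral>t. u t * v t \<partial>M\<bar> \<le> orlicz_norm M \<Phi> u"
  unfolding orlicz_norm_def using assms
  by (intro SUP_upper) (auto simp: orlicz_class_def intro: le_less_trans)

text \<open>Young's inequality for each test function of modular at most 1; this is the easy
  comparison with the Amemiya norm, at \<open>k = 1\<close>.\<close>

lemma orlicz_norm_le_modular:
  assumes [measurable]: "u \<in> borel_measurable M"
  shows "orlicz_norm M \<Phi> u \<le> 1 + modular M \<Phi> u"
  unfolding orlicz_norm_def
proof (rule SUP_least)
  fix v assume "v \<in> {v \<in> orlicz_class M \<Psi>. modular M \<Psi> v \<le> 1}"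
  then have [measurable]: "v \<in> borel_measurable M" and J: "modular M \<Psi> v \<le> 1"
    by (auto simp: orlicz_class_def)
  have "ennreal \<bar>\<integral>t. u t * v t \<partial>M\<bar> \<le> (\<integral>\<^sup>+ t. ennreal \<bar>u t * v t\<bar> \<partial>M)"
  proof (cases "integrable M (\<lambda>t. u t * v t)")
    case True
    then show ?thesis using integral_norm_bound_ennreal[OF True] by simp
  \<comment> \<open>A function that is not integrable has integral 0 by convention.\<close>
  qed (simp add: not_integrable_integral_eq)
  also have "\<dots> \<le> modular M \<Phi> u + modular M \<Psi> v" by (rule Young_integral) measurable
  also have "\<dots> \<le> modular M \<Phi> u + 1" using J by (rule add_left_mono)
  finally show "ennreal \<bar>\<integral>t. u t * v t \<partial>M\<bar> \<le> 1 + modular M \<Phi> u" by (simp add: add.commute)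
qed

lemma orlicz_norm_scale: "orlicz_norm M \<Phi> (\<lambda>t. c * u t) = ennreal \<bar>c\<bar> * orlicz_norm M \<Phi> u"
  unfolding orlicz_norm_def
  by (simp add: SUP_mult_left_ennreal mult.assoc abs_mult ennreal_mult)

lemma orlicz_norm_finite:
  assumes "u \<in> orlicz_space M \<Phi>" shows "orlicz_norm M \<Phi> u < \<infinity>"
proof -
  note [measurable] = space_measurable[OF assms]
  obtain l where l: "0 < l" "modular M \<Phi> (\<lambda>t. l * u t) < \<infinity>" using assms by (rule space_cases)
  have "orlicz_norm M \<Phi> (\<lambda>t. l * u t) \<le> 1 + modular M \<Phi> (\<lambda>t. l * u t)"
    by (rule orlicz_norm_le_modular) measurable
  also have "\<dots> < \<infinity>" using l by simp
  finally have "ennreal l * orlicz_norm M \<Phi> u < \<infinity>" using l by (simp add: orlicz_norm_scale)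
  then show ?thesis using l by (auto simp: ennreal_mult_less_top)
qed

text \<open>Agrees with \<open>orlicz_norm\<close> on the Orlicz space by
  \<open>orlicz_norm_eq\<close>; elsewhere an infinite norm would turn into 0.\<close>

definition rnorm :: "('a \<Rightarrow> real) \<Rightarrow> real" where
  "rnorm u = enn2real (orlicz_norm M \<Phi> u)"

lemma rnorm_nonneg [simp]: "0 \<le> rnorm u"
  by (simp add: rnorm_def)

lemma orlicz_norm_eq: "u \<in> orlicz_space M \<Phi> \<Longrightarrow> orlicz_norm M \<Phi> u = ennreal (rnorm u)"
  using orlicz_norm_finite by (simp add: rnorm_def)

lemma rnorm_scale: "rnorm (\<lambda>t. c * u t) = \<bar>c\<bar> * rnorm u"
  by (simp add: rnorm_def orlicz_norm_scale enn2real_mult)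

lemma integral_le_rnorm:
  assumes "u \<in> orlicz_space M \<Phi>" "v \<in> borel_measurable M" "modular M \<Psi> v \<le> 1"
  shows "(\<integral>t. u t * v t \<partial>M) \<le> rnorm u"
proof -
  have "ennreal \<bar>\<integral>t. u t * v t \<partial>M\<bar> \<le> ennreal (rnorm u)"
    using orlicz_norm_upper[OF assms(2,3), of u] assms(1) by (simp add: orlicz_norm_eq)
  then show ?thesis by simp
qed

text \<open>The absolute value in the norm is removed by passing from \<open>v\<close> to
  \<open>- v\<close>, which has the same modular.\<close>

lemma rnorm_approx:
  assumes u: "u \<in> orlicz_space M \<Phi>" and e: "0 < e"
  obtains v where "v \<in> borel_measurable M" "modular M \<Psi> v \<le> 1" "rnorm u - e \<le> (\<integral>t. u t * v t \<partial>M)"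
proof (cases "rnorm u - e < 0")
  case True
  then show ?thesis using that[of "\<lambda>t. 0"] conjugate_pair.zero[OF dual_pair] by (auto simp: modular_def)
next
  case False
  then have "ennreal (rnorm u - e) < orlicz_norm M \<Phi> u"
    using e by (simp add: orlicz_norm_eq[OF u] ennreal_less_iff)
  then obtain v where v: "v \<in> borel_measurable M" "modular M \<Psi> v \<le> 1"
    "ennreal (rnorm u - e) < ennreal \<bar>\<integral>t. u t * v t \<partial>M\<bar>"
    unfolding orlicz_norm_def less_SUP_iff by (auto simp: orlicz_class_def)
  then have le: "rnorm u - e \<le> \<bar>\<integral>t. u t * v t \<partial>M\<bar>"
    using False by (simp add: ennreal_less_iff)
  show ?thesis
  proof (cases "0 \<le> (\<integral>t. u t * v t \<partial>M)")
    case True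
    then show ?thesis using that[of v] v le by simp
  next
    case False
    have "modular M \<Psi> (\<lambda>t. - v t) = modular M \<Psi> v" by (simp add: modular_def)
    then show ?thesis using that[of "\<lambda>t. - v t"] v le False by simp
  qed
qed

text \<open>By \<open>modular_conjugate_le\<close> with the roles exchanged, it suffices to bound
  the integral of \<open>u * \<bar>w\<bar>\<close> by \<open>modular M \<Psi> u + 1\<close>.
  Dividing \<open>u\<close> by \<open>max 1 j\<close> makes it a test function for the norm of
  \<open>w\<close>, and \<open>max 1 j \<le> j + 1\<close>.\<close>

lemma modular_le_one_if_rnorm_le_one:
  assumes w: "w \<in> orlicz_space M \<Phi>" and le: "rnorm w \<le> 1"
  shows "modular M \<Phi> w \<le> 1"
proof -
  interpret dual: conjugate_pair M \<Psi> \<Phi> by (rule dual_pair)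
  note [measurable] = space_measurable[OF w]
  show ?thesis
  proof (rule dual.modular_conjugate_le)
    fix u :: "'a \<Rightarrow> real"
    assume [measurable]: "u \<in> borel_measurable M" and pos: "\<And>t. 0 \<le> u t" and J: "modular M \<Psi> u < \<infinity>"
    define j where "j = enn2real (modular M \<Psi> u)"
    have j: "modular M \<Psi> u = ennreal j" "0 \<le> j" using J by (simp_all add: j_def)
    define c where "c = 1 / max 1 j"
    have c: "0 < c" "c \<le> 1" "c * j \<le> 1" by (auto simp: c_def field_simps)
    have int: "integrable M (\<lambda>t. u t * \<bar>w t\<bar>)"
      using integrable_prod[OF space_solid[OF w] dual.spaceI[OF _ J], of "\<lambda>t. \<bar>w t\<bar>"]
      by (simp add: mult.commute)
    have "modular M \<Psi> (\<lambda>t. sgn (w t) * (c * u t)) \<le> modular M \<Psi> (\<lambda>t. c * u t)"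
      using c by (intro dual.modular_mono) (auto simp: abs_mult sgn_real_def)
    also have "\<dots> \<le> ennreal c * modular M \<Psi> u" using c by (intro dual.modular_scale) auto
    also have "\<dots> \<le> 1" using c j by (simp add: ennreal_mult'[symmetric] ennreal_le_1)
    finally have "(\<integral>t. w t * (sgn (w t) * (c * u t)) \<partial>M) \<le> rnorm w"
      by (intro integral_le_rnorm w) measurable
    moreover have "w t * (sgn (w t) * (c * u t)) = c * (u t * \<bar>w t\<bar>)" for t
      by (simp add: sgn_real_def)
    ultimately have "c * (\<integral>t. u t * \<bar>w t\<bar> \<partial>M) \<le> 1" using le by simp
    then have "(\<integral>t. u t * \<bar>w t\<bar> \<partial>M) \<le> max 1 j" by (simp add: c_def field_simps)
    then have "(\<integral>t. u t * \<bar>w t\<bar> \<partial>M) \<le> j + 1" using j by simp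
    then have "ennreal (\<integral>t. u t * \<bar>w t\<bar> \<partial>M) \<le> ennreal j + 1"
      using j by (metis ennreal_1 ennreal_leI ennreal_plus zero_le_one)
    then show "(\<integral>\<^sup>+ t. ennreal (u t * \<bar>w t\<bar>) \<partial>M) \<le> modular M \<Psi> u + 1"
      using int pos by (simp add: nn_integral_eq_integral j)
  qed measurable
qed

section \<open>Bounded functionals and their norms\<close>

lemma dual_cong:
  "f \<in> orlicz_dual M \<Phi> \<Longrightarrow> u \<in> orlicz_space M \<Phi> \<Longrightarrow> w \<in> orlicz_space M \<Phi> \<Longrightarrow>
    AE t in M. u t = w t \<Longrightarrow> f u = f w"
  unfolding orlicz_dual_def by blast

lemma dual_add:
  "f \<in> orlicz_dual M \<Phi> \<Longrightarrow> u \<in> orlicz_space M \<Phi> \<Longrightarrow> w \<in> orlicz_space M \<Phi> \<Longrightarrow>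
    f (\<lambda>t. u t + w t) = f u + f w"
  unfolding orlicz_dual_def by blast

lemma dual_scale:
  "f \<in> orlicz_dual M \<Phi> \<Longrightarrow> u \<in> orlicz_space M \<Phi> \<Longrightarrow> f (\<lambda>t. c * u t) = c * f u"
  unfolding orlicz_dual_def by blast

lemma dual_diff:
  assumes "f \<in> orlicz_dual M \<Phi>" "u \<in> orlicz_space M \<Phi>" "w \<in> orlicz_space M \<Phi>"
  shows "f (\<lambda>t. u t - w t) = f u - f w"
  using dual_add[OF assms(1,2) space_scale[OF assms(3), of "- 1"]] dual_scale[OF assms(1,3), of "- 1"]
  by simp

lemma dual_AE_zero:
  assumes f: "f \<in> orlicz_dual M \<Phi>" and u: "u \<in> orlicz_space M \<Phi>" and "AE t in M. u t = 0"
  shows "f u = 0"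
  using dual_cong[OF f u space_zero assms(3)] dual_scale[OF f space_zero, of 0] by simp

lemma dual_finite: "f \<in> orlicz_dual M \<Phi> \<Longrightarrow> functional_norm M \<Phi> f < \<infinity>"
  unfolding orlicz_dual_def by blast

definition fnorm :: "(('a \<Rightarrow> real) \<Rightarrow> real) \<Rightarrow> real" where
  "fnorm f = enn2real (functional_norm M \<Phi> f)"

lemma fnorm_nonneg [simp]: "0 \<le> fnorm f"
  by (simp add: fnorm_def)

lemma functional_norm_eq: "f \<in> orlicz_dual M \<Phi> \<Longrightarrow> functional_norm M \<Phi> f = ennreal (fnorm f)"
  using dual_finite by (simp add: fnorm_def)

lemma dual_bound:
  assumes f: "f \<in> orlicz_dual M \<Phi>" and u: "u \<in> orlicz_space M \<Phi>"
  shows "\<bar>f u\<bar> \<le> fnorm f * rnorm u"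
proof (cases "AE t in M. u t = 0")
  case True
  then show ?thesis using dual_AE_zero[OF f u] by simp
next
  case False
  have "ennreal \<bar>f u\<bar> / orlicz_norm M \<Phi> u \<le> functional_norm M \<Phi> f"
    unfolding functional_norm_def using u False by (intro SUP_upper) auto
  then have "ennreal \<bar>f u\<bar> / ennreal (rnorm u) \<le> ennreal (fnorm f)"
    using f u by (simp add: functional_norm_eq orlicz_norm_eq)
  then show ?thesis by (simp add: ennreal_divide_le_iff_mult)
qed

lemma functional_norm_leI:
  assumes "0 \<le> c" "\<And>u. u \<in> orlicz_space M \<Phi> \<Longrightarrow> \<bar>f u\<bar> \<le> c * rnorm u"
  shows "functional_norm M \<Phi> f \<le> ennreal c"
  unfolding functional_norm_def
  using assms by (intro SUP_least) (auto simp: orlicz_norm_eq ennreal_divide_le_iff_mult)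

lemma functional_norm_scale:
  assumes "0 \<le> c" shows "functional_norm M \<Phi> (\<lambda>u. c * f u) = ennreal c * functional_norm M \<Phi> f"
  unfolding functional_norm_def using assms
  by (simp add: SUP_mult_left_ennreal abs_mult ennreal_mult ennreal_times_divide)

lemma dual_scale_mem:
  assumes f: "f \<in> orlicz_dual M \<Phi>" and "0 \<le> c"
  shows "(\<lambda>u. c * f u) \<in> orlicz_dual M \<Phi>"
proof -
  have "functional_norm M \<Phi> (\<lambda>u. c * f u) < \<infinity>"
    using functional_norm_scale[OF \<open>0 \<le> c\<close>, of f] functional_norm_eq[OF f]
    by (simp add: ennreal_mult_less_top)
  then show ?thesis
    unfolding orlicz_dual_def mem_Collect_eq
    using dual_cong[OF f] dual_add[OF f] dual_scale[OF f]
    by (intro conjI ballI allI impI) (simp_all only: distrib_left mult.left_commute)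
qed

lemma dual_uminus_mem:
  assumes f: "f \<in> orlicz_dual M \<Phi>" shows "(\<lambda>u. - f u) \<in> orlicz_dual M \<Phi>"
proof -
  have "functional_norm M \<Phi> (\<lambda>u. - f u) = functional_norm M \<Phi> f"
    by (simp add: functional_norm_def)
  then have "functional_norm M \<Phi> (\<lambda>u. - f u) < \<infinity>" using dual_finite[OF f] by simp
  then show ?thesis
    unfolding orlicz_dual_def mem_Collect_eq
    using dual_cong[OF f] dual_add[OF f] dual_scale[OF f]
    by (intro conjI ballI allI impI) (simp_all only: minus_add_distrib mult_minus_right)
qed

text \<open>Functions dominated by \<open>u\<close> have uniformly bounded norm, because
  \<open>orlicz_norm_le_modular\<close> bounds the norm of \<open>l * w\<close> through the modular
  of \<open>l * u\<close>. Hence the real suprema in the positive part range over bounded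
  sets.\<close>

lemma dual_order_bounded:
  assumes f: "f \<in> orlicz_dual M \<Phi>" and u: "u \<in> orlicz_space M \<Phi>"
  shows "\<exists>B. \<forall>w\<in>orlicz_space M \<Phi>. (AE t in M. \<bar>w t\<bar> \<le> \<bar>u t\<bar>) \<longrightarrow> \<bar>f w\<bar> \<le> B"
proof -
  obtain l where l: "0 < l" "modular M \<Phi> (\<lambda>t. l * u t) < \<infinity>" using u by (rule space_cases)
  define i where "i = enn2real (modular M \<Phi> (\<lambda>t. l * u t))"
  have i: "modular M \<Phi> (\<lambda>t. l * u t) = ennreal i" "0 \<le> i" using l by (simp_all add: i_def)
  show ?thesis
  proof (intro exI[of _ "fnorm f * ((1 + i) / l)"] ballI impI)
    fix w assume w: "w \<in> orlicz_space M \<Phi>" and le: "AE t in M. \<bar>w t\<bar> \<le> \<bar>u t\<bar>"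
    note [measurable] = space_measurable[OF w]
    have "orlicz_norm M \<Phi> (\<lambda>t. l * w t) \<le> 1 + modular M \<Phi> (\<lambda>t. l * w t)"
      by (rule orlicz_norm_le_modular) measurable
    also have "modular M \<Phi> (\<lambda>t. l * w t) \<le> modular M \<Phi> (\<lambda>t. l * u t)"
      using le l by (intro modular_mono) (auto simp: abs_mult elim!: eventually_mono)
    finally have "ennreal (rnorm (\<lambda>t. l * w t)) \<le> ennreal (1 + i)"
      using i by (simp add: orlicz_norm_eq[OF space_scale[OF w]] add_left_mono)
    then have "l * rnorm w \<le> 1 + i" using i l by (simp add: rnorm_scale ennreal_le_iff del: ennreal_plus)
    then have "rnorm w \<le> (1 + i) / l" using l by (simp add: field_simps)
    then show "\<bar>f w\<bar> \<le> fnorm f * ((1 + i) / l)"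
      using dual_bound[OF f w] mult_left_mono[OF _ fnorm_nonneg] order_trans by blast
  qed
qed

end

section \<open>Purely singular functionals\<close>

context musielak_pair
begin

text \<open>The positive part of \<open>f\<close> on the positive cone; applied to the negative of
  \<open>f\<close> it gives the negative part.\<close>

definition order_sup :: "(('a \<Rightarrow> real) \<Rightarrow> real) \<Rightarrow> ('a \<Rightarrow> real) \<Rightarrow> real" where
  "order_sup f u = (SUP w\<in>{w \<in> orlicz_space M \<Phi>. AE t in M. 0 \<le> w t \<and> w t \<le> u t}. f w)"

lemma order_sup_upper:
  assumes f: "f \<in> orlicz_dual M \<Phi>" and u: "u \<in> orlicz_space M \<Phi>" and w: "w \<in> orlicz_space M \<Phi>"
    and le: "AE t in M. 0 \<le> w t \<and> w t \<le> u t"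
  shows "f w \<le> order_sup f u"
  unfolding order_sup_def
proof (rule cSUP_upper)
  obtain B where B: "\<And>w. w \<in> orlicz_space M \<Phi> \<Longrightarrow> AE t in M. \<bar>w t\<bar> \<le> \<bar>u t\<bar> \<Longrightarrow> \<bar>f w\<bar> \<le> B"
    using dual_order_bounded[OF f u] by blast
  show "bdd_above (f ` {w \<in> orlicz_space M \<Phi>. AE t in M. 0 \<le> w t \<and> w t \<le> u t})"
  proof (rule bdd_aboveI2)
    fix w assume w: "w \<in> {w \<in> orlicz_space M \<Phi>. AE t in M. 0 \<le> w t \<and> w t \<le> u t}"
    then have "AE t in M. 0 \<le> w t \<and> w t \<le> u t" by blast
    then have "AE t in M. \<bar>w t\<bar> \<le> \<bar>u t\<bar>" by eventually_elim auto
    then have "\<bar>f w\<bar> \<le> B" using w by (intro B) auto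
    then show "f w \<le> B" by simp
  qed
qed (use w le in auto)

lemma order_sup_least:
  assumes "AE t in M. 0 \<le> u t"
    and "\<And>w. w \<in> orlicz_space M \<Phi> \<Longrightarrow> AE t in M. 0 \<le> w t \<and> w t \<le> u t \<Longrightarrow> f w \<le> c"
  shows "order_sup f u \<le> c"
  unfolding order_sup_def
proof (rule cSUP_least)
  show "{w \<in> orlicz_space M \<Phi>. AE t in M. 0 \<le> w t \<and> w t \<le> u t} \<noteq> {}"
    using assms(1) space_zero by auto
qed (use assms in auto)

lemma order_sup_nonneg:
  assumes "f \<in> orlicz_dual M \<Phi>" "u \<in> orlicz_space M \<Phi>" "AE t in M. 0 \<le> u t"
  shows "0 \<le> order_sup f u"
  using order_sup_upper[OF assms(1,2) space_zero] dual_AE_zero[OF assms(1) space_zero] assms(3) by simp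

lemma order_sup_mono:
  assumes f: "f \<in> orlicz_dual M \<Phi>" and u: "u \<in> orlicz_space M \<Phi>" and w: "AE t in M. 0 \<le> w t"
    and le: "AE t in M. w t \<le> u t"
  shows "order_sup f w \<le> order_sup f u"
proof (rule order_sup_least[OF w])
  fix x assume x: "x \<in> orlicz_space M \<Phi>" "AE t in M. 0 \<le> x t \<and> x t \<le> w t"
  have "AE t in M. 0 \<le> x t \<and> x t \<le> u t" using x(2) le by eventually_elim auto
  then show "f x \<le> order_sup f u" by (rule order_sup_upper[OF f u x(1)])
qed

lemma order_sup_add_le:
  assumes f: "f \<in> orlicz_dual M \<Phi>"
    and a: "a \<in> orlicz_space M \<Phi>" "AE t in M. 0 \<le> a t"
    and b: "b \<in> orlicz_space M \<Phi>" "AE t in M. 0 \<le> b t"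
  shows "order_sup f (\<lambda>t. a t + b t) \<le> order_sup f a + order_sup f b"
proof (rule order_sup_least)
  show "AE t in M. 0 \<le> a t + b t" using a(2) b(2) by eventually_elim auto
  fix w assume w: "w \<in> orlicz_space M \<Phi>" and le: "AE t in M. 0 \<le> w t \<and> w t \<le> a t + b t"
  note [measurable] = space_measurable[OF w] space_measurable[OF a(1)]
  \<comment> \<open>Riesz decomposition: a minorant of \<open>a + b\<close> splits into
    \<open>min w a\<close> and a remainder below \<open>b\<close>.\<close>
  define x where "x t = min (w t) (a t)" for t
  have x: "x \<in> orlicz_space M \<Phi>"
  proof (rule space_solid[OF w])
    show "AE t in M. \<bar>x t\<bar> \<le> \<bar>w t\<bar>" using le a(2) by eventually_elim (auto simp: x_def)
  qed (unfold x_def, measurable)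
  have "f w = f (\<lambda>t. x t + (w t - x t))" by simp
  also have "\<dots> = f x + f (\<lambda>t. w t - x t)" by (rule dual_add[OF f x space_diff[OF w x]])
  also have "f x \<le> order_sup f a"
    by (rule order_sup_upper[OF f a(1) x]) (use le a(2) in \<open>eventually_elim, auto simp: x_def\<close>)
  also have "f (\<lambda>t. w t - x t) \<le> order_sup f b"
    by (rule order_sup_upper[OF f b(1) space_diff[OF w x]])
      (use le b(2) in \<open>eventually_elim, auto simp: x_def min_def\<close>)
  finally show "f w \<le> order_sup f a + order_sup f b" by simp
qed

lemma order_sup_add_ge:
  assumes f: "f \<in> orlicz_dual M \<Phi>"
    and a: "a \<in> orlicz_space M \<Phi>" "AE t in M. 0 \<le> a t"
    and b: "b \<in> orlicz_space M \<Phi>" "AE t in M. 0 \<le> b t"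
  shows "order_sup f a + order_sup f b \<le> order_sup f (\<lambda>t. a t + b t)"
proof -
  have "order_sup f a \<le> order_sup f (\<lambda>t. a t + b t) - order_sup f b"
  proof (rule order_sup_least[OF a(2)])
    fix w assume w: "w \<in> orlicz_space M \<Phi>" "AE t in M. 0 \<le> w t \<and> w t \<le> a t"
    have "order_sup f b \<le> order_sup f (\<lambda>t. a t + b t) - f w"
    proof (rule order_sup_least[OF b(2)])
      fix z assume z: "z \<in> orlicz_space M \<Phi>" "AE t in M. 0 \<le> z t \<and> z t \<le> b t"
      have "f (\<lambda>t. w t + z t) \<le> order_sup f (\<lambda>t. a t + b t)"
      proof (rule order_sup_upper[OF f space_add[OF a(1) b(1)] space_add[OF w(1) z(1)]])
        show "AE t in M. 0 \<le> w t + z t \<and> w t + z t \<le> a t + b t"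
          using w(2) z(2) by eventually_elim auto
      qed
      then show "f z \<le> order_sup f (\<lambda>t. a t + b t) - f w"
        using dual_add[OF f w(1) z(1)] by simp
    qed
    then show "f w \<le> order_sup f (\<lambda>t. a t + b t) - order_sup f b" by simp
  qed
  then show ?thesis by simp
qed

text \<open>The map from \<open>w\<close> to \<open>u - w\<close> preserves the order interval from
  0 to \<open>u\<close> and turns \<open>- f w\<close> into \<open>f (u - w) - f u\<close>. This is
  one half of the Jordan decomposition.\<close>

lemma le_order_sup_diff:
  assumes f: "f \<in> orlicz_dual M \<Phi>" and u: "u \<in> orlicz_space M \<Phi>" "AE t in M. 0 \<le> u t"
  shows "f u \<le> order_sup f u - order_sup (\<lambda>u. - f u) u"
proof -
  have "order_sup (\<lambda>u. - f u) u \<le> order_sup f u - f u"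
  proof (rule order_sup_least[OF u(2)])
    fix w assume w: "w \<in> orlicz_space M \<Phi>" "AE t in M. 0 \<le> w t \<and> w t \<le> u t"
    have "f (\<lambda>t. u t - w t) \<le> order_sup f u"
      by (rule order_sup_upper[OF f u(1) space_diff[OF u(1) w(1)]])
        (use w(2) in \<open>eventually_elim, auto\<close>)
    then show "- f w \<le> order_sup f u - f u" using dual_diff[OF f u(1) w(1)] by simp
  qed
  then show ?thesis by simp
qed

lemma functional_pos_part_eq_order_sup:
  assumes f: "f \<in> orlicz_dual M \<Phi>" and u: "AE t in M. 0 \<le> u t"
  shows "functional_pos_part M \<Phi> f u = order_sup f u"
proof -
  have "(AE t in M. 0 \<le> w t \<and> w t \<le> max (u t) 0) \<longleftrightarrow> (AE t in M. 0 \<le> w t \<and> w t \<le> u t)" for w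
    by (rule eventually_cong[OF u]) auto
  then have 1: "order_sup f (\<lambda>t. max (u t) 0) = order_sup f u" by (simp add: order_sup_def)
  have neg: "AE t in M. 0 \<le> max (- u t) 0 \<and> max (- u t) 0 \<le> 0" using u by eventually_elim auto
  have 2: "order_sup f (\<lambda>t. max (- u t) 0) = 0"
  proof (rule antisym)
    show "order_sup f (\<lambda>t. max (- u t) 0) \<le> 0"
    proof (rule order_sup_least)
      fix w assume w: "w \<in> orlicz_space M \<Phi>" "AE t in M. 0 \<le> w t \<and> w t \<le> max (- u t) 0"
      have "AE t in M. w t = 0" using w(2) neg by eventually_elim auto
      then show "f w \<le> 0" using dual_AE_zero[OF f w(1)] by simp
    qed auto
    have "(AE t in M. 0 \<le> w t \<and> w t \<le> max (- u t) 0) \<longleftrightarrow> (AE t in M. 0 \<le> w t \<and> w t \<le> 0)" for w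
      by (rule eventually_cong[OF u]) auto
    then have "order_sup f (\<lambda>t. max (- u t) 0) = order_sup f (\<lambda>t. 0)" by (simp add: order_sup_def)
    then show "0 \<le> order_sup f (\<lambda>t. max (- u t) 0)" using order_sup_nonneg[OF f space_zero] by simp
  qed
  show ?thesis using 1 2
    unfolding functional_pos_part_def cone_extension_def order_sup_def by simp
qed

text \<open>The order continuous component of the positive part of \<open>f\<close>, on the positive
  cone.\<close>

definition oc_inf :: "(('a \<Rightarrow> real) \<Rightarrow> real) \<Rightarrow> ('a \<Rightarrow> real) \<Rightarrow> real" where
  "oc_inf f u = (INF U\<in>increasing_to M \<Phi> u. SUP n. order_sup f (U n))"

lemma increasing_toD:
  assumes "U \<in> increasing_to M \<Phi> u"
  shows "U n \<in> orlicz_space M \<Phi>" "AE t in M. 0 \<le> U n t" "AE t in M. U n t \<le> u t"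
    "AE t in M. (\<lambda>n. U n t) \<longlonglongrightarrow> u t" "AE t in M. \<forall>n. 0 \<le> U n t"
proof -
  have *: "AE t in M. (\<forall>n. 0 \<le> U n t) \<and> incseq (\<lambda>n. U n t) \<and> (\<lambda>n. U n t) \<longlonglongrightarrow> u t"
    using assms by (simp add: increasing_to_def)
  show "U n \<in> orlicz_space M \<Phi>" using assms by (simp add: increasing_to_def)
  show "AE t in M. 0 \<le> U n t" "AE t in M. (\<lambda>n. U n t) \<longlonglongrightarrow> u t" "AE t in M. \<forall>n. 0 \<le> U n t"
    using * by (auto elim!: eventually_mono)
  show "AE t in M. U n t \<le> u t" using * by eventually_elim (auto intro: incseq_le)
qed

lemma const_increasing_to:
  assumes "u \<in> orlicz_space M \<Phi>" "AE t in M. 0 \<le> u t"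
  shows "(\<lambda>n. u) \<in> increasing_to M \<Phi> u"
  using assms by (auto simp: increasing_to_def incseq_def)

lemma order_sup_le_SUP:
  assumes f: "f \<in> orlicz_dual M \<Phi>" and u: "u \<in> orlicz_space M \<Phi>" and U: "U \<in> increasing_to M \<Phi> u"
  shows "order_sup f (U n) \<le> (SUP n. order_sup f (U n))"
proof (rule cSUP_upper)
  have "order_sup f (U n) \<le> order_sup f u" for n
    by (rule order_sup_mono[OF f u increasing_toD(2,3)[OF U]])
  then show "bdd_above (range (\<lambda>n. order_sup f (U n)))" by (rule bdd_aboveI2)
qed simp

lemma SUP_order_sup_nonneg:
  assumes f: "f \<in> orlicz_dual M \<Phi>" and u: "u \<in> orlicz_space M \<Phi>" and U: "U \<in> increasing_to M \<Phi> u"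
  shows "0 \<le> (SUP n. order_sup f (U n))"
  using order_sup_nonneg[OF f increasing_toD(1,2)[OF U]] order_sup_le_SUP[OF f u U] order_trans
  by blast

lemma oc_inf_le:
  assumes f: "f \<in> orlicz_dual M \<Phi>" and u: "u \<in> orlicz_space M \<Phi>" and U: "U \<in> increasing_to M \<Phi> u"
  shows "oc_inf f u \<le> (SUP n. order_sup f (U n))"
  unfolding oc_inf_def
  by (rule cINF_lower[OF bdd_belowI2 U]) (rule SUP_order_sup_nonneg[OF f u])

lemma oc_inf_le_order_sup:
  assumes f: "f \<in> orlicz_dual M \<Phi>" and u: "u \<in> orlicz_space M \<Phi>" "AE t in M. 0 \<le> u t"
  shows "oc_inf f u \<le> order_sup f u"
  using oc_inf_le[OF f u(1) const_increasing_to[OF u]] by simp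

lemma oc_inf_approx:
  assumes f: "f \<in> orlicz_dual M \<Phi>" and u: "u \<in> orlicz_space M \<Phi>" "AE t in M. 0 \<le> u t" and e: "0 < e"
  obtains U where "U \<in> increasing_to M \<Phi> u" "\<And>n. order_sup f (U n) \<le> oc_inf f u + e"
proof -
  have "increasing_to M \<Phi> u \<noteq> {}" using const_increasing_to[OF u] by blast
  moreover have "bdd_below ((\<lambda>U. SUP n. order_sup f (U n)) ` increasing_to M \<Phi> u)"
    by (rule bdd_belowI2) (rule SUP_order_sup_nonneg[OF f u(1)])
  moreover have "oc_inf f u < oc_inf f u + e" using e by simp
  ultimately obtain U where U: "U \<in> increasing_to M \<Phi> u" "(SUP n. order_sup f (U n)) < oc_inf f u + e"
    using cINF_less_iff[of "increasing_to M \<Phi> u" "\<lambda>U. SUP n. order_sup f (U n)"]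
    unfolding oc_inf_def by blast
  show ?thesis
  proof (rule that[OF U(1)])
    fix n show "order_sup f (U n) \<le> oc_inf f u + e"
      using order_sup_le_SUP[OF f u(1) U(1), of n] U(2) by simp
  qed
qed

lemma oc_inf_add_le:
  assumes f: "f \<in> orlicz_dual M \<Phi>"
    and a: "a \<in> orlicz_space M \<Phi>" "AE t in M. 0 \<le> a t"
    and b: "b \<in> orlicz_space M \<Phi>" "AE t in M. 0 \<le> b t"
  shows "oc_inf f (\<lambda>t. a t + b t) \<le> oc_inf f a + oc_inf f b"
proof (rule field_le_epsilon)
  fix e :: real assume "0 < e"
  then have e: "0 < e / 2" by simp
  obtain U where U: "U \<in> increasing_to M \<Phi> a" "\<And>n. order_sup f (U n) \<le> oc_inf f a + e / 2"
    using oc_inf_approx[OF f a e] by blast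
  obtain V where V: "V \<in> increasing_to M \<Phi> b" "\<And>n. order_sup f (V n) \<le> oc_inf f b + e / 2"
    using oc_inf_approx[OF f b e] by blast
  have W: "(\<lambda>n t. U n t + V n t) \<in> increasing_to M \<Phi> (\<lambda>t. a t + b t)"
    using U(1) V(1) unfolding increasing_to_def
    by (auto simp: incseq_def intro!: space_add tendsto_add add_mono elim!: eventually_elim2)
  have "oc_inf f (\<lambda>t. a t + b t) \<le> (SUP n. order_sup f (\<lambda>t. U n t + V n t))"
    by (rule oc_inf_le[OF f space_add[OF a(1) b(1)] W])
  also have "\<dots> \<le> oc_inf f a + oc_inf f b + e"
  proof (rule cSUP_least)
    fix n
    have "order_sup f (\<lambda>t. U n t + V n t) \<le> order_sup f (U n) + order_sup f (V n)"
      by (rule order_sup_add_le[OF f increasing_toD(1,2)[OF U(1)] increasing_toD(1,2)[OF V(1)]])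
    then show "order_sup f (\<lambda>t. U n t + V n t) \<le> oc_inf f a + oc_inf f b + e"
      using U(2)[of n] V(2)[of n] by simp
  qed simp
  finally show "oc_inf f (\<lambda>t. a t + b t) \<le> oc_inf f a + oc_inf f b + e" .
qed

lemma oc_component_of_positive_eq_oc_inf:
  assumes f: "f \<in> orlicz_dual M \<Phi>" and u: "u \<in> orlicz_space M \<Phi>" "AE t in M. 0 \<le> u t"
  shows "oc_component_of_positive M \<Phi> (functional_pos_part M \<Phi> f) u = oc_inf f u"
proof -
  have eq: "(INF U\<in>increasing_to M \<Phi> w. SUP n. functional_pos_part M \<Phi> f (U n)) = oc_inf f w" for w
    unfolding oc_inf_def
    by (intro INF_cong SUP_cong refl functional_pos_part_eq_order_sup[OF f] increasing_toD(2))
  have inc: "increasing_to M \<Phi> (\<lambda>t. max (u t) 0) = increasing_to M \<Phi> u"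
  proof -
    have "(AE t in M. (\<forall>n. 0 \<le> U n t) \<and> incseq (\<lambda>n. U n t) \<and> (\<lambda>n. U n t) \<longlonglongrightarrow> max (u t) 0) \<longleftrightarrow>
      (AE t in M. (\<forall>n. 0 \<le> U n t) \<and> incseq (\<lambda>n. U n t) \<and> (\<lambda>n. U n t) \<longlonglongrightarrow> u t)" for U
      by (rule eventually_cong[OF u(2)]) (simp add: max_def)
    then show ?thesis by (simp add: increasing_to_def)
  qed
  have neg: "(\<lambda>t. max (- u t) 0) \<in> orlicz_space M \<Phi>"
    using space_measurable[OF u(1)] by (intro space_solid[OF u(1)]) auto
  have neg0: "AE t in M. max (- u t) 0 = 0" using u(2) by eventually_elim simp
  have "oc_inf f (\<lambda>t. max (- u t) 0) = 0"
  proof (rule antisym)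
    have "order_sup f (\<lambda>t. max (- u t) 0) \<le> 0"
    proof (rule order_sup_least)
      fix w assume w: "w \<in> orlicz_space M \<Phi>" "AE t in M. 0 \<le> w t \<and> w t \<le> max (- u t) 0"
      have "AE t in M. w t = 0" using w(2) neg0 by eventually_elim auto
      then show "f w \<le> 0" using dual_AE_zero[OF f w(1)] by simp
    qed auto
    then show "oc_inf f (\<lambda>t. max (- u t) 0) \<le> 0"
      using oc_inf_le_order_sup[OF f neg] by simp
    show "0 \<le> oc_inf f (\<lambda>t. max (- u t) 0)"
      unfolding oc_inf_def
      using const_increasing_to[OF neg] SUP_order_sup_nonneg[OF f neg] by (intro cINF_greatest) auto
  qed
  moreover have "oc_inf f (\<lambda>t. max (u t) 0) = oc_inf f u" by (simp add: oc_inf_def inc)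
  ultimately show ?thesis
    unfolding oc_component_of_positive_def cone_extension_def eq by simp
qed

text \<open>The positive and the negative part of \<open>f\<close> are disjoint: a common minorant \<open>c\<close> of the two
  satisfies \<open>f\<^sup>+ \<le> f\<^sup>+ - c\<close>, because \<open>f\<^sup>+ - c\<close> still dominates \<open>f\<close>.\<close>

lemma oc_inf_eq_0:
  assumes f: "f \<in> orlicz_dual M \<Phi>" and sing: "purely_singular M \<Phi> f"
    and u: "u \<in> orlicz_space M \<Phi>" "AE t in M. 0 \<le> u t"
  shows "oc_inf f u = 0" "oc_inf (\<lambda>u. - f u) u = 0"
proof -
  have f': "(\<lambda>u. - f u) \<in> orlicz_dual M \<Phi>" by (rule dual_uminus_mem[OF f])
  \<comment> \<open>Pure singularity only says that the order continuous components of the two parts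
    have difference 0. Their common value is the minorant \<open>c\<close>.\<close>
  have eq: "oc_inf f w = oc_inf (\<lambda>u. - f u) w" if w: "w \<in> orlicz_space M \<Phi>" "AE t in M. 0 \<le> w t" for w
    using sing w(1) oc_component_of_positive_eq_oc_inf[OF f w] oc_component_of_positive_eq_oc_inf[OF f' w]
    unfolding purely_singular_def oc_component_def functional_neg_part_def by simp
  \<comment> \<open>Below \<open>u\<close>, \<open>f w\<close> is at most the positive part minus
    \<open>c\<close> at \<open>w\<close>; subadditivity of \<open>c\<close>, superadditivity of the
    positive part and \<open>c \<le> order_sup f\<close> on \<open>u - w\<close> carry this bound
    from \<open>w\<close> to \<open>u\<close>.\<close>
  have "order_sup f u \<le> order_sup f u - oc_inf f u"
  proof (rule order_sup_least[OF u(2)])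
    fix w assume w: "w \<in> orlicz_space M \<Phi>" and le: "AE t in M. 0 \<le> w t \<and> w t \<le> u t"
    have w0: "AE t in M. 0 \<le> w t" using le by eventually_elim simp
    have d: "(\<lambda>t. u t - w t) \<in> orlicz_space M \<Phi>" "AE t in M. 0 \<le> u t - w t"
      using space_diff[OF u(1) w] le by (auto elim!: eventually_mono)
    have "oc_inf f u \<le> oc_inf f w + oc_inf f (\<lambda>t. u t - w t)"
      using oc_inf_add_le[OF f w w0 d] by simp
    moreover have "oc_inf f (\<lambda>t. u t - w t) \<le> order_sup f (\<lambda>t. u t - w t)"
      by (rule oc_inf_le_order_sup[OF f d])
    moreover have "order_sup f w + order_sup f (\<lambda>t. u t - w t) \<le> order_sup f u"
      using order_sup_add_ge[OF f w w0 d] by simp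
    moreover have "f w \<le> order_sup f w - order_sup (\<lambda>u. - f u) w"
      by (rule le_order_sup_diff[OF f w w0])
    moreover have "oc_inf f w \<le> order_sup (\<lambda>u. - f u) w"
      using oc_inf_le_order_sup[OF f' w w0] eq[OF w w0] by simp
    ultimately show "f w \<le> order_sup f u - oc_inf f u" by simp
  qed
  moreover have "0 \<le> oc_inf f u"
    unfolding oc_inf_def
    using const_increasing_to[OF u] SUP_order_sup_nonneg[OF f u(1)] by (intro cINF_greatest) auto
  ultimately show "oc_inf f u = 0" by simp
  then show "oc_inf (\<lambda>u. - f u) u = 0" using eq[OF u] by simp
qed

text \<open>The form in which singularity is used: up to \<open>e\<close>, functions dominated by
  \<open>u\<close> are invisible off each \<open>A n\<close>. The sets need not decrease; almost
  every point merely leaves them eventually. The bound is uniform in \<open>n\<close> and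
  \<open>z\<close>.\<close>

definition concentrated :: "(('a \<Rightarrow> real) \<Rightarrow> real) \<Rightarrow> bool" where
  "concentrated g \<longleftrightarrow> (\<forall>u\<in>orlicz_space M \<Phi>. \<forall>e>0. \<exists>A::nat \<Rightarrow> 'a set.
     (\<forall>n. A n \<in> sets M) \<and> (AE t in M. \<forall>\<^sub>F n in sequentially. t \<notin> A n) \<and>
     (\<forall>n. \<forall>z\<in>orlicz_space M \<Phi>. (\<forall>t\<in>space M. \<bar>z t\<bar> \<le> \<bar>u t\<bar>) \<longrightarrow> (\<forall>t\<in>A n. z t = 0) \<longrightarrow> \<bar>g z\<bar> \<le> e))"

lemma concentratedE:
  assumes "concentrated g" "u \<in> orlicz_space M \<Phi>" "0 < e"
  obtains A :: "nat \<Rightarrow> 'a set" where "\<And>n. A n \<in> sets M"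
    "AE t in M. \<forall>\<^sub>F n in sequentially. t \<notin> A n"
    "\<And>n z. z \<in> orlicz_space M \<Phi> \<Longrightarrow> (\<And>t. t \<in> space M \<Longrightarrow> \<bar>z t\<bar> \<le> \<bar>u t\<bar>) \<Longrightarrow>
       (\<And>t. t \<in> A n \<Longrightarrow> z t = 0) \<Longrightarrow> \<bar>g z\<bar> \<le> e"
proof -
  obtain A :: "nat \<Rightarrow> 'a set" where A: "\<forall>n. A n \<in> sets M"
    "AE t in M. \<forall>\<^sub>F n in sequentially. t \<notin> A n"
    "\<forall>n. \<forall>z\<in>orlicz_space M \<Phi>. (\<forall>t\<in>space M. \<bar>z t\<bar> \<le> \<bar>u t\<bar>) \<longrightarrow> (\<forall>t\<in>A n. z t = 0) \<longrightarrow> \<bar>g z\<bar> \<le> e"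
    using assms unfolding concentrated_def by blast
  show thesis by (rule that[of A]) (use A in blast)+
qed

lemma concentrated_scale:
  assumes g: "concentrated g" and c: "0 < c" shows "concentrated (\<lambda>u. c * g u)"
  unfolding concentrated_def
proof (intro ballI allI impI)
  fix u and e :: real assume u: "u \<in> orlicz_space M \<Phi>" and "0 < e"
  then have e: "0 < e / c" using c by simp
  obtain A :: "nat \<Rightarrow> 'a set" where A: "\<And>n. A n \<in> sets M"
    "AE t in M. \<forall>\<^sub>F n in sequentially. t \<notin> A n"
    "\<And>n z. z \<in> orlicz_space M \<Phi> \<Longrightarrow> (\<And>t. t \<in> space M \<Longrightarrow> \<bar>z t\<bar> \<le> \<bar>u t\<bar>) \<Longrightarrow>
       (\<And>t. t \<in> A n \<Longrightarrow> z t = 0) \<Longrightarrow> \<bar>g z\<bar> \<le> e / c"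
    using concentratedE[OF g u e] by metis
  have "\<bar>c * g z\<bar> \<le> e" if "\<bar>g z\<bar> \<le> e / c" for z
    using that c by (simp add: abs_mult field_simps)
  then show "\<exists>A::nat \<Rightarrow> 'a set.
     (\<forall>n. A n \<in> sets M) \<and> (AE t in M. \<forall>\<^sub>F n in sequentially. t \<notin> A n) \<and>
     (\<forall>n. \<forall>z\<in>orlicz_space M \<Phi>. (\<forall>t\<in>space M. \<bar>z t\<bar> \<le> \<bar>u t\<bar>) \<longrightarrow> (\<forall>t\<in>A n. z t = 0) \<longrightarrow> \<bar>c * g z\<bar> \<le> e)"
    using A by (intro exI[of _ A]) blast
qed

text \<open>Both parts of \<open>f\<close> have order continuous component 0, so there are sequences
  increasing to \<open>\<bar>u\<bar>\<close> on which they stay small. Off \<open>A n\<close>, half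
  of \<open>\<bar>u\<bar>\<close> lies below both \<open>U n\<close> and \<open>V n\<close>, which
  bounds \<open>f\<close> on halves of the positive and negative parts of \<open>z\<close>.\<close>

lemma purely_singular_concentrated:
  assumes f: "f \<in> orlicz_dual M \<Phi>" and sing: "purely_singular M \<Phi> f"
  shows "concentrated f"
  unfolding concentrated_def
proof (intro ballI allI impI)
  fix u and e :: real assume u: "u \<in> orlicz_space M \<Phi>" and "0 < e"
  then have e: "0 < e / 4" by simp
  note [measurable] = space_measurable[OF u]
  have f': "(\<lambda>u. - f u) \<in> orlicz_dual M \<Phi>" by (rule dual_uminus_mem[OF f])
  have au: "(\<lambda>t. \<bar>u t\<bar>) \<in> orlicz_space M \<Phi>" "AE t in M. 0 \<le> \<bar>u t\<bar>"
    by (auto intro: space_solid[OF u])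
  obtain U where U: "U \<in> increasing_to M \<Phi> (\<lambda>t. \<bar>u t\<bar>)" "\<And>n. order_sup f (U n) \<le> e / 4"
    using oc_inf_approx[OF f au e] oc_inf_eq_0[OF f sing au] by auto
  obtain V where V: "V \<in> increasing_to M \<Phi> (\<lambda>t. \<bar>u t\<bar>)" "\<And>n. order_sup (\<lambda>u. - f u) (V n) \<le> e / 4"
    using oc_inf_approx[OF f' au e] oc_inf_eq_0[OF f sing au] by auto
  note [measurable] = space_measurable[OF increasing_toD(1)[OF U(1)]] space_measurable[OF increasing_toD(1)[OF V(1)]]
  \<comment> \<open>The factor 1/2 leaves a strict gap where \<open>u t\<close> is nonzero, so
    convergence of both sequences takes \<open>t\<close> out of \<open>A n\<close>
    eventually.\<close>
  define A where "A n = {t \<in> space M. min (U n t) (V n t) < \<bar>u t\<bar> / 2}" for n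
  have "A n \<in> sets M" for n unfolding A_def by measurable
  moreover have "AE t in M. \<forall>\<^sub>F n in sequentially. t \<notin> A n"
    using increasing_toD(4)[OF U(1)] increasing_toD(4)[OF V(1)]
      increasing_toD(5)[OF U(1)] increasing_toD(5)[OF V(1)]
  proof eventually_elim
    case (elim t)
    show ?case
    proof (cases "u t = 0")
      case True
      then show ?thesis using elim(3,4) by (intro always_eventually allI) (auto simp: A_def min_less_iff_disj not_less)
    next
      case False
      then have "\<bar>u t\<bar> / 2 < \<bar>u t\<bar>" by simp
      then have "\<forall>\<^sub>F n in sequentially. \<bar>u t\<bar> / 2 < U n t" "\<forall>\<^sub>F n in sequentially. \<bar>u t\<bar> / 2 < V n t"
        using elim(1,2) by (simp_all only: order_tendstoD)
      then show ?thesis by eventually_elim (auto simp: A_def)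
    qed
  qed
  moreover have "\<bar>f z\<bar> \<le> e" if z: "z \<in> orlicz_space M \<Phi>" and le: "\<forall>t\<in>space M. \<bar>z t\<bar> \<le> \<bar>u t\<bar>"
    and zero: "\<forall>t\<in>A n. z t = 0" for z n
  proof -
    note [measurable] = space_measurable[OF z]
    have half: "\<bar>f y\<bar> \<le> e / 4" if y: "y \<in> orlicz_space M \<Phi>" "\<And>t. 0 \<le> y t" "\<And>t. y t \<le> \<bar>z t\<bar> / 2" for y
    proof -
      have bound: "AE t in M. 0 \<le> y t \<and> y t \<le> U n t \<and> y t \<le> V n t"
        using increasing_toD(2)[OF U(1), of n] increasing_toD(2)[OF V(1), of n] AE_space
      proof eventually_elim
        case (elim t)
        show ?case
        proof (cases "t \<in> A n")
          case True
          then show ?thesis using y(2,3)[of t] zero elim by force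
        next
          case False
          then have "\<not> min (U n t) (V n t) < \<bar>u t\<bar> / 2" using elim unfolding A_def by blast
          then have "\<bar>u t\<bar> / 2 \<le> U n t" "\<bar>u t\<bar> / 2 \<le> V n t" by linarith+
          then show ?thesis using y(2,3)[of t] le elim by force
        qed
      qed
      have "f y \<le> order_sup f (U n)"
        by (rule order_sup_upper[OF f increasing_toD(1)[OF U(1)] y(1)]) (use bound in \<open>eventually_elim, simp\<close>)
      moreover have "- f y \<le> order_sup (\<lambda>u. - f u) (V n)"
        by (rule order_sup_upper[OF f' increasing_toD(1)[OF V(1)] y(1)]) (use bound in \<open>eventually_elim, simp\<close>)
      ultimately show ?thesis using U(2)[of n] V(2)[of n] by simp
    qed
    \<comment> \<open>As \<open>z = 2 * (y1 - y2)\<close>, two bounds by \<open>e / 4\<close> add up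
      to \<open>e\<close> after doubling.\<close>
    define y1 y2 where "y1 t = max (z t) 0 / 2" and "y2 t = max (- z t) 0 / 2" for t
    have y1: "y1 \<in> orlicz_space M \<Phi>"
      unfolding y1_def by (rule space_solid[OF z]) auto
    have y2: "y2 \<in> orlicz_space M \<Phi>"
      unfolding y2_def by (rule space_solid[OF z]) auto
    have "z = (\<lambda>t. 2 * (y1 t - y2 t))" by (auto simp: y1_def y2_def max_def)
    then have "f z = 2 * (f y1 - f y2)"
      using dual_scale[OF f space_diff[OF y1 y2], of 2] dual_diff[OF f y1 y2] by simp
    moreover have "\<bar>f y1\<bar> \<le> e / 4" "\<bar>f y2\<bar> \<le> e / 4"
      using half[OF y1] half[OF y2] by (auto simp: y1_def y2_def)
    ultimately show ?thesis by simp
  qed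
  ultimately show "\<exists>A::nat \<Rightarrow> 'a set.
     (\<forall>n. A n \<in> sets M) \<and> (AE t in M. \<forall>\<^sub>F n in sequentially. t \<notin> A n) \<and>
     (\<forall>n. \<forall>z\<in>orlicz_space M \<Phi>. (\<forall>t\<in>space M. \<bar>z t\<bar> \<le> \<bar>u t\<bar>) \<longrightarrow> (\<forall>t\<in>A n. z t = 0) \<longrightarrow> \<bar>f z\<bar> \<le> e)"
    by blast
qed

end

section \<open>The norm formula\<close>

context musielak_pair
begin

lemma functional_norm_le_one:
  assumes f: "f \<in> orlicz_dual M \<Phi>" and g: "g \<in> orlicz_dual M \<Phi>" and conc: "concentrated g"
    and v: "v \<in> orlicz_space M \<Psi>"
    and fg: "\<And>u. u \<in> orlicz_space M \<Phi> \<Longrightarrow> f u = (\<integral>t. u t * v t \<partial>M) + g u"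
    and le: "modular M \<Psi> v + functional_norm M \<Phi> g \<le> 1"
  shows "functional_norm M \<Phi> f \<le> 1"
proof -
  interpret dual: conjugate_pair M \<Psi> \<Phi> by (rule dual_pair)
  note [measurable] = dual.space_measurable[OF v]
  define s where "s = fnorm g"
  have s: "functional_norm M \<Phi> g = ennreal s" "0 \<le> s" using functional_norm_eq[OF g] by (simp_all add: s_def)
  have "ennreal s \<le> modular M \<Psi> v + ennreal s" by simp
  then have "ennreal s \<le> 1" using le s order_trans by metis
  then have s1: "s \<le> 1" by (simp add: ennreal_le_1)
  have main: "f u \<le> rnorm u" if u: "u \<in> orlicz_space M \<Phi>" for u
  proof (rule field_le_epsilon)
    fix e' :: real assume "0 < e'"
    \<comment> \<open>The three errors are \<open>g z1\<close>, the integral of \<open>u * v\<close>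
      over \<open>A n\<close>, and \<open>s\<close> times the error in norming
      \<open>z2\<close>.\<close>
    define e where "e = e' / 3"
    have e: "0 < e" using \<open>0 < e'\<close> by (simp add: e_def)
    note [measurable] = space_measurable[OF u]
    obtain A where A [measurable]: "\<And>n. A n \<in> sets M" and
      A_lim: "AE t in M. \<forall>\<^sub>F n in sequentially. t \<notin> A n" and
      small: "\<And>n z. z \<in> orlicz_space M \<Phi> \<Longrightarrow> (\<And>t. t \<in> space M \<Longrightarrow> \<bar>z t\<bar> \<le> \<bar>u t\<bar>) \<Longrightarrow>
         (\<And>t. t \<in> A n \<Longrightarrow> z t = 0) \<Longrightarrow> \<bar>g z\<bar> \<le> e"
      using concentratedE[OF conc u e] by metis
    have int: "integrable M (\<lambda>t. u t * v t)" by (rule integrable_prod[OF u v])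
    have "(\<lambda>n. \<integral>t. indicator (A n) t * (u t * v t) \<partial>M) \<longlonglongrightarrow> (\<integral>t. 0 \<partial>M)"
    proof (rule integral_dominated_convergence[where w = "\<lambda>t. \<bar>u t * v t\<bar>"])
      show "AE t in M. (\<lambda>n. indicator (A n) t * (u t * v t)) \<longlonglongrightarrow> 0"
        using A_lim by eventually_elim (auto intro!: tendsto_eventually elim!: eventually_mono)
      show "AE t in M. norm (indicator (A n) t * (u t * v t)) \<le> \<bar>u t * v t\<bar>" for n
        by (rule AE_I2) (auto simp: indicator_def)
      show "integrable M (\<lambda>t. \<bar>u t * v t\<bar>)" using int by (rule integrable_abs)
    qed measurable
    then have "\<forall>\<^sub>F n in sequentially. (\<integral>t. indicator (A n) t * (u t * v t) \<partial>M) < e"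
      using e by (intro order_tendstoD) auto
    then obtain n where n: "(\<integral>t. indicator (A n) t * (u t * v t) \<partial>M) < e"
      unfolding eventually_sequentially by blast
    define z1 z2 where "z1 t = (if t \<in> A n then 0 else u t)" and "z2 t = (if t \<in> A n then u t else 0)" for t
    have z1: "z1 \<in> orlicz_space M \<Phi>" and z2: "z2 \<in> orlicz_space M \<Phi>"
      unfolding z1_def z2_def using u by (intro space_if; simp)+
    obtain v' where v' [measurable]: "v' \<in> borel_measurable M" and J': "modular M \<Psi> v' \<le> 1"
      and approx: "rnorm z2 - e \<le> (\<integral>t. z2 t * v' t \<partial>M)"
      using rnorm_approx[OF z2 e] by blast
    have v'_space: "v' \<in> orlicz_space M \<Psi>"
      using J' by (intro dual.spaceI) (auto intro: le_less_trans)
    \<comment> \<open>Since \<open>s \<le> 1\<close>, scaling \<open>v'\<close> by \<open>s\<close>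
      reduces its modular to at most \<open>s\<close>, just what \<open>modular M \<Psi> v\<close>
      leaves free.\<close>
    define v'' where "v'' t = (if t \<in> A n then s * v' t else v t)" for t
    have [measurable]: "v'' \<in> borel_measurable M" unfolding v''_def by measurable
    have "modular M \<Psi> v'' \<le> modular M \<Psi> v + modular M \<Psi> (\<lambda>t. s * v' t)"
      by (intro dual.modular_split_le AE_I2) (auto simp: v''_def)
    also have "modular M \<Psi> (\<lambda>t. s * v' t) \<le> ennreal s * modular M \<Psi> v'"
      using s s1 by (intro dual.modular_scale) auto
    also have "\<dots> \<le> ennreal s * 1" using J' by (rule mult_left_mono) simp
    finally have "modular M \<Psi> v'' \<le> 1" using le s by (simp add: add_left_mono)
    then have bound: "(\<integral>t. u t * v'' t \<partial>M) \<le> rnorm u" by (intro integral_le_rnorm u) measurable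
    have int1: "integrable M (\<lambda>t. indicator (A n) t * (u t * v t))"
      using integrable_mult_indicator[OF A int, of n] by simp
    have int2: "integrable M (\<lambda>t. z2 t * v' t)" by (rule integrable_prod[OF z2 v'_space])
    have "(\<integral>t. u t * v'' t \<partial>M) = (\<integral>t. (u t * v t - indicator (A n) t * (u t * v t)) + s * (z2 t * v' t) \<partial>M)"
      by (intro Bochner_Integration.integral_cong) (auto simp: v''_def z2_def)
    also have "\<dots> = (\<integral>t. u t * v t \<partial>M) - (\<integral>t. indicator (A n) t * (u t * v t) \<partial>M) + s * (\<integral>t. z2 t * v' t \<partial>M)"
      using int int1 int2 by simp
    finally have eq: "(\<integral>t. u t * v'' t \<partial>M) = \<dots>" .
    have "f u = (\<integral>t. u t * v t \<partial>M) + g (\<lambda>t. z1 t + z2 t)"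
      using fg[OF u] by (simp add: z1_def z2_def if_distrib cong: if_cong)
    also have "g (\<lambda>t. z1 t + z2 t) = g z1 + g z2" by (rule dual_add[OF g z1 z2])
    finally have fu: "f u = (\<integral>t. u t * v t \<partial>M) + (g z1 + g z2)" .
    have "\<bar>g z1\<bar> \<le> e" by (rule small[OF z1, of n]) (auto simp: z1_def)
    moreover have "g z2 \<le> s * rnorm z2" using dual_bound[OF g z2] by (simp add: s_def)
    moreover have "s * (rnorm z2 - e) \<le> s * (\<integral>t. z2 t * v' t \<partial>M)"
      using approx s by (intro mult_left_mono) auto
    moreover have "s * e \<le> 1 * e" using s1 e by (intro mult_right_mono) auto
    ultimately show "f u \<le> rnorm u + e'"
      using fu eq bound n by (simp add: e_def algebra_simps)
  qed
  have "functional_norm M \<Phi> f \<le> ennreal 1"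
  proof (rule functional_norm_leI)
    fix u assume u: "u \<in> orlicz_space M \<Phi>"
    have "f (\<lambda>t. - 1 * u t) \<le> rnorm (\<lambda>t. - 1 * u t)" by (rule main[OF space_scale[OF u]])
    then show "\<bar>f u\<bar> \<le> 1 * rnorm u"
      using main[OF u] unfolding dual_scale[OF f u] rnorm_scale by simp
  qed simp
  then show ?thesis by simp
qed

lemma modular_plus_functional_norm_le_one:
  assumes f: "f \<in> orlicz_dual M \<Phi>" and g: "g \<in> orlicz_dual M \<Phi>" and conc: "concentrated g"
    and v: "v \<in> orlicz_space M \<Psi>"
    and fg: "\<And>u. u \<in> orlicz_space M \<Phi> \<Longrightarrow> f u = (\<integral>t. u t * v t \<partial>M) + g u"
    and le: "functional_norm M \<Phi> f \<le> 1"
  shows "modular M \<Psi> v + functional_norm M \<Phi> g \<le> 1"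
proof -
  interpret dual: conjugate_pair M \<Psi> \<Phi> by (rule dual_pair)
  note [measurable] = dual.space_measurable[OF v]
  have "fnorm f \<le> 1" using le functional_norm_eq[OF f] by (simp add: ennreal_le_1)
  then have f_le: "f u \<le> rnorm u" if "u \<in> orlicz_space M \<Phi>" for u
    using dual_bound[OF f that] mult_right_mono[of "fnorm f" 1 "rnorm u"] by simp
  \<comment> \<open>Glue \<open>u\<close> off a small set to \<open>w\<close> on it: \<open>f_v\<close> sees only \<open>u\<close> and \<open>g\<close> sees only \<open>w\<close>.\<close>
  have glue: "(\<integral>t. u t * v t \<partial>M) + g w \<le> 1 + enn2real (modular M \<Phi> u)"
    if u [measurable]: "u \<in> borel_measurable M" and Iu: "modular M \<Phi> u < \<infinity>"
      and w [measurable]: "w \<in> borel_measurable M" and Iw: "modular M \<Phi> w < \<infinity>" for u w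
  proof (rule field_le_epsilon)
    fix e' :: real assume "0 < e'"
    define e where "e = e' / 2"
    have e: "0 < e" using \<open>0 < e'\<close> by (simp add: e_def)
    have uL: "u \<in> orlicz_space M \<Phi>" and wL: "w \<in> orlicz_space M \<Phi>"
      using Iu Iw by (auto intro: spaceI)
    \<comment> \<open>A common majorant of \<open>u\<close> and \<open>w\<close>, so that a single
      sequence of sets serves both.\<close>
    define m where "m t = max \<bar>u t\<bar> \<bar>w t\<bar>" for t
    have [measurable]: "m \<in> borel_measurable M" unfolding m_def by measurable
    have "modular M \<Phi> m \<le> modular M \<Phi> u + modular M \<Phi> w"
      by (intro modular_split_le AE_I2) (auto simp: m_def)
    then have mL: "m \<in> orlicz_space M \<Phi>" using Iu Iw by (intro spaceI) (auto intro: le_less_trans)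
    obtain A where A [measurable]: "\<And>n. A n \<in> sets M" and
      A_lim: "AE t in M. \<forall>\<^sub>F n in sequentially. t \<notin> A n" and
      small: "\<And>n z. z \<in> orlicz_space M \<Phi> \<Longrightarrow> (\<And>t. t \<in> space M \<Longrightarrow> \<bar>z t\<bar> \<le> \<bar>m t\<bar>) \<Longrightarrow>
         (\<And>t. t \<in> A n \<Longrightarrow> z t = 0) \<Longrightarrow> \<bar>g z\<bar> \<le> e"
      using concentratedE[OF conc mL e] by metis
    define x where "x n t = (if t \<in> A n then w t else u t)" for n t
    have x: "x n \<in> orlicz_space M \<Phi>" for n unfolding x_def by (intro space_if A uL wL)
    note [measurable] = space_measurable[OF x]
    define i where "i n = enn2real (modular M \<Phi> (\<lambda>t. indicator (A n) t * w t))" for n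
    have fin: "modular M \<Phi> (\<lambda>t. indicator (A n) t * w t) < \<infinity>" for n
      by (rule le_less_trans[OF modular_mono Iw], rule AE_I2) (simp add: indicator_def)
    have I: "modular M \<Phi> (\<lambda>t. indicator (A n) t * w t) = ennreal (i n)" for n
      using fin by (simp add: i_def)
    have i0: "0 \<le> i n" for n by (simp add: i_def)
    have "i \<longlonglongrightarrow> 0"
      using modular_tendsto_0[OF w A Iw A_lim] unfolding i_def by (intro tendsto_enn2real) simp_all
    have "(\<lambda>n. \<integral>t. x n t * v t \<partial>M) \<longlonglongrightarrow> (\<integral>t. u t * v t \<partial>M)"
    proof (rule integral_dominated_convergence[where w = "\<lambda>t. \<bar>m t * v t\<bar>"])
      show "integrable M (\<lambda>t. \<bar>m t * v t\<bar>)" using integrable_prod[OF mL v] by simp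
      show "AE t in M. (\<lambda>n. x n t * v t) \<longlonglongrightarrow> u t * v t"
        using A_lim by eventually_elim (auto simp: x_def intro!: tendsto_eventually elim!: eventually_mono)
      show "AE t in M. norm (x n t * v t) \<le> \<bar>m t * v t\<bar>" for n
        by (rule AE_I2) (auto simp: x_def m_def abs_mult intro!: mult_right_mono)
    qed measurable
    then have lim1: "(\<lambda>n. (\<integral>t. x n t * v t \<partial>M) + (g w - 2 * e)) \<longlonglongrightarrow> (\<integral>t. u t * v t \<partial>M) + (g w - 2 * e)"
      by (intro tendsto_intros)
    have lim2: "(\<lambda>n. 1 + (enn2real (modular M \<Phi> u) + i n)) \<longlonglongrightarrow> 1 + (enn2real (modular M \<Phi> u) + 0)"
      using \<open>i \<longlonglongrightarrow> 0\<close> by (intro tendsto_intros)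
    have "(\<integral>t. x n t * v t \<partial>M) + (g w - 2 * e) \<le> 1 + (enn2real (modular M \<Phi> u) + i n)" for n
    proof -
      define y1 y2 where "y1 t = (if t \<in> A n then 0 else u t)" and "y2 t = (if t \<in> A n then 0 else w t)" for t
      have y1: "y1 \<in> orlicz_space M \<Phi>" and y2: "y2 \<in> orlicz_space M \<Phi>"
        unfolding y1_def y2_def using uL wL by (intro space_if; simp)+
      \<comment> \<open>The functions \<open>y1\<close> and \<open>y2\<close> vanish on
        \<open>A n\<close>, so \<open>g (x n)\<close> differs from \<open>g w\<close> by at most
        \<open>2 * e\<close>, which is \<open>e'\<close>.\<close>
      have "x n = (\<lambda>t. (w t - y2 t) + y1 t)" by (auto simp: x_def y1_def y2_def)
      then have gx: "g (x n) = g w - g y2 + g y1"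
        using dual_add[OF g space_diff[OF wL y2] y1] dual_diff[OF g wL y2] by simp
      have "\<bar>g y1\<bar> \<le> e" by (rule small[OF y1, of n]) (auto simp: y1_def m_def)
      moreover have "\<bar>g y2\<bar> \<le> e" by (rule small[OF y2, of n]) (auto simp: y2_def m_def)
      ultimately have "(\<integral>t. x n t * v t \<partial>M) + (g w - 2 * e) \<le> f (x n)"
        using fg[OF x, of n] gx by simp
      also have "\<dots> \<le> rnorm (x n)" by (rule f_le[OF x])
      also have "\<dots> \<le> 1 + (enn2real (modular M \<Phi> u) + i n)"
      proof -
        have "ennreal (rnorm (x n)) \<le> 1 + modular M \<Phi> (x n)"
          using orlicz_norm_le_modular[of "x n"] orlicz_norm_eq[OF x, of n] by simp
        also have "modular M \<Phi> (x n) \<le> modular M \<Phi> u + modular M \<Phi> (\<lambda>t. indicator (A n) t * w t)"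
          by (intro modular_split_le AE_I2) (auto simp: x_def)
        also have "\<dots> = ennreal (enn2real (modular M \<Phi> u)) + ennreal (i n)"
          using Iu by (simp add: I)
        also have "1 + \<dots> = ennreal (1 + (enn2real (modular M \<Phi> u) + i n))"
          using i0[of n] by simp
        finally have "ennreal (rnorm (x n)) \<le> ennreal (1 + (enn2real (modular M \<Phi> u) + i n))"
          by (simp add: add_left_mono)
        then show ?thesis using i0[of n] by (subst (asm) ennreal_le_iff) auto
      qed
      finally show ?thesis .
    qed
    then have "(\<integral>t. u t * v t \<partial>M) + (g w - 2 * e) \<le> 1 + (enn2real (modular M \<Phi> u) + 0)"
      by (intro LIMSEQ_le[OF lim1 lim2]) blast
    then show "(\<integral>t. u t * v t \<partial>M) + g w \<le> 1 + enn2real (modular M \<Phi> u) + e'"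
      by (simp add: e_def)
  qed
  have zero: "(\<lambda>t. 0) \<in> borel_measurable M" "modular M \<Phi> (\<lambda>t. 0) = 0" by (simp_all add: modular_def)
  \<comment> \<open>For fixed \<open>w\<close>, letting \<open>u\<close> vary turns
    \<open>glue\<close> into a bound on the conjugate modular. Taking \<open>u = 0\<close> gives
    \<open>g w \<le> 1\<close>, so \<open>1 - g w\<close> is not truncated.\<close>
  have bound: "modular M \<Psi> v \<le> ennreal (1 - g w) \<and> g w \<le> 1"
    if w: "w \<in> borel_measurable M" "modular M \<Phi> w < \<infinity>" for w
  proof
    show gw: "g w \<le> 1" using glue[OF zero(1) _ w] zero by simp
    show "modular M \<Psi> v \<le> ennreal (1 - g w)"
    proof (rule modular_conjugate_le)
      fix u :: "'a \<Rightarrow> real"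
      assume u [measurable]: "u \<in> borel_measurable M" and pos: "\<And>t. 0 \<le> u t" and Iu: "modular M \<Phi> u < \<infinity>"
      have int: "integrable M (\<lambda>t. u t * \<bar>v t\<bar>)"
        using integrable_prod[OF spaceI[OF u Iu] dual.space_solid[OF v], of "\<lambda>t. \<bar>v t\<bar>"] by simp
      \<comment> \<open>Multiplication by the sign of \<open>v\<close> turns the signed integral in
        \<open>glue\<close> into that of \<open>u * \<bar>v\<bar>\<close>.\<close>
      have "modular M \<Phi> (\<lambda>t. sgn (v t) * u t) \<le> modular M \<Phi> u"
        by (intro modular_mono AE_I2) (simp add: abs_mult sgn_real_def)
      then have I: "modular M \<Phi> (\<lambda>t. sgn (v t) * u t) < \<infinity>"
        "enn2real (modular M \<Phi> (\<lambda>t. sgn (v t) * u t)) \<le> enn2real (modular M \<Phi> u)"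
        using Iu by (auto intro: le_less_trans enn2real_mono)
      have "(\<lambda>t. sgn (v t) * u t * v t) = (\<lambda>t. u t * \<bar>v t\<bar>)" by (auto simp: sgn_real_def)
      then have "(\<integral>t. u t * \<bar>v t\<bar> \<partial>M) \<le> enn2real (modular M \<Phi> u) + (1 - g w)"
        using glue[OF _ I(1) w] I(2) by simp
      then have "ennreal (\<integral>t. u t * \<bar>v t\<bar> \<partial>M) \<le> ennreal (enn2real (modular M \<Phi> u) + (1 - g w))"
        by (rule ennreal_leI)
      also have "\<dots> = modular M \<Phi> u + ennreal (1 - g w)" using gw Iu by simp
      finally show "(\<integral>\<^sup>+ t. ennreal (u t * \<bar>v t\<bar>) \<partial>M) \<le> modular M \<Phi> u + ennreal (1 - g w)"
        using int pos by (simp add: nn_integral_eq_integral)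
    qed measurable
  qed
  have "modular M \<Psi> v \<le> 1"
    using bound[OF zero(1)] zero(2) dual_AE_zero[OF g space_zero] by simp
  then obtain j where j: "modular M \<Psi> v = ennreal j" "0 \<le> j" "j \<le> 1"
    by (cases "modular M \<Psi> v") (auto simp: ennreal_le_1 top_unique)
  have g_le: "g w \<le> 1 - j" if "w \<in> borel_measurable M" "modular M \<Phi> w < \<infinity>" for w
    using bound[OF that] by (auto simp: j ennreal_le_iff)
  have g_rnorm: "g w \<le> (1 - j) * rnorm w" if w: "w \<in> orlicz_space M \<Phi>" for w
  proof (rule field_le_epsilon)
    fix e :: real assume e: "0 < e"
    \<comment> \<open>Adding \<open>e\<close> keeps the divisor positive when the norm of
      \<open>w\<close> is 0; the quotient lies in the unit ball and hence has modular at most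
      1.\<close>
    define r where "r = rnorm w + e"
    have r: "0 < r" using e by (simp add: r_def add_nonneg_pos)
    have wr: "(\<lambda>t. 1 / r * w t) \<in> orlicz_space M \<Phi>" by (rule space_scale[OF w])
    have "rnorm (\<lambda>t. 1 / r * w t) \<le> 1" unfolding rnorm_scale using r e by (simp add: r_def)
    then have "modular M \<Phi> (\<lambda>t. 1 / r * w t) \<le> 1" by (rule modular_le_one_if_rnorm_le_one[OF wr])
    then have "g (\<lambda>t. 1 / r * w t) \<le> 1 - j"
      by (intro g_le space_measurable[OF wr]) (auto intro: le_less_trans)
    then have "g w \<le> (1 - j) * r" using r unfolding dual_scale[OF g w] by (simp add: field_simps)
    also have "\<dots> \<le> (1 - j) * rnorm w + e" using j e by (simp add: r_def algebra_simps)
    finally show "g w \<le> (1 - j) * rnorm w + e" .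
  qed
  have "functional_norm M \<Phi> g \<le> ennreal (1 - j)"
  proof (rule functional_norm_leI)
    fix w assume w: "w \<in> orlicz_space M \<Phi>"
    have "g (\<lambda>t. - 1 * w t) \<le> (1 - j) * rnorm (\<lambda>t. - 1 * w t)" by (rule g_rnorm[OF space_scale[OF w]])
    then show "\<bar>g w\<bar> \<le> (1 - j) * rnorm w"
      using g_rnorm[OF w] unfolding dual_scale[OF g w] rnorm_scale by simp
  qed (use j in simp)
  then have "modular M \<Psi> v + functional_norm M \<Phi> g \<le> ennreal j + ennreal (1 - j)"
    unfolding j(1) by (rule add_left_mono)
  also have "\<dots> = 1" using j by (simp flip: ennreal_plus)
  finally show ?thesis .
qed

text \<open>Dividing everything by \<open>l\<close> reduces admissibility of \<open>l\<close> to the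
  two implications at level 1. The admissible \<open>l\<close> are thus the positive ones not below
  \<open>fnorm f\<close>.\<close>

lemma functional_norm_formula:
  assumes f: "f \<in> orlicz_dual M \<Phi>" and g: "g \<in> orlicz_dual M \<Phi>" and sing: "purely_singular M \<Phi> g"
    and v: "v \<in> orlicz_space M \<Psi>"
    and fg: "\<And>u. u \<in> orlicz_space M \<Phi> \<Longrightarrow> f u = (\<integral>t. u t * v t \<partial>M) + g u"
  shows "functional_norm M \<Phi> f =
    (INF l\<in>{l::real. 0 < l \<and>
        modular M \<Psi> (\<lambda>t. v t / l) + functional_norm M \<Phi> (\<lambda>u. g u / l) \<le> 1}. ennreal l)"
proof -
  interpret dual: conjugate_pair M \<Psi> \<Phi> by (rule dual_pair)
  have iff: "modular M \<Psi> (\<lambda>t. v t / l) + functional_norm M \<Phi> (\<lambda>u. g u / l) \<le> 1 \<longleftrightarrow>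
      fnorm f \<le> l" if l: "0 < l" for l
  proof -
    define c where "c = 1 / l"
    have c: "0 < c" using l by (simp add: c_def)
    let ?f = "\<lambda>u. c * f u" and ?g = "\<lambda>u. c * g u" and ?v = "\<lambda>t. c * v t"
    have f': "?f \<in> orlicz_dual M \<Phi>" and g': "?g \<in> orlicz_dual M \<Phi>"
      using c by (auto intro: dual_scale_mem f g)
    have conc: "concentrated ?g"
      by (rule concentrated_scale[OF purely_singular_concentrated[OF g sing] c])
    have v': "?v \<in> orlicz_space M \<Psi>" by (rule dual.space_scale[OF v])
    have fg': "?f u = (\<integral>t. u t * ?v t \<partial>M) + ?g u" if "u \<in> orlicz_space M \<Phi>" for u
      using fg[OF that] by (simp add: distrib_left mult.left_commute)
    have "modular M \<Psi> ?v + functional_norm M \<Phi> ?g \<le> 1 \<longleftrightarrow> functional_norm M \<Phi> ?f \<le> 1"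
      using functional_norm_le_one[OF f' g' conc v' fg']
        modular_plus_functional_norm_le_one[OF f' g' conc v' fg'] by blast
    also have "functional_norm M \<Phi> ?f = ennreal (c * fnorm f)"
      using c by (simp add: functional_norm_scale functional_norm_eq[OF f] ennreal_mult)
    also have "\<dots> \<le> 1 \<longleftrightarrow> fnorm f \<le> l" using l by (simp add: ennreal_le_1 c_def)
    finally show ?thesis by (simp add: c_def)
  qed
  have "{l::real. 0 < l \<and>
        modular M \<Psi> (\<lambda>t. v t / l) + functional_norm M \<Phi> (\<lambda>u. g u / l) \<le> 1} = {l. 0 < l \<and> fnorm f \<le> l}"
    using iff by auto
  moreover have "(INF l\<in>{l. 0 < l \<and> fnorm f \<le> l}. ennreal l) = ennreal (fnorm f)"
  proof (rule antisym)
    show "(INF l\<in>{l. 0 < l \<and> fnorm f \<le> l}. ennreal l) \<le> ennreal (fnorm f)"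
    \<comment> \<open>The infimum is not attained when \<open>fnorm f = 0\<close>, hence the
      approximation from above.\<close>
    proof (rule ennreal_le_epsilon)
      fix e :: real assume "0 < e"
      then have "(INF l\<in>{l. 0 < l \<and> fnorm f \<le> l}. ennreal l) \<le> ennreal (fnorm f + e)"
        by (intro INF_lower) (auto intro: add_nonneg_pos)
      then show "(INF l\<in>{l. 0 < l \<and> fnorm f \<le> l}. ennreal l) \<le> ennreal (fnorm f) + ennreal e"
        using \<open>0 < e\<close> by simp
    qed
  qed (auto intro: INF_greatest ennreal_leI)
  ultimately show ?thesis by (simp add: functional_norm_eq[OF f])
qed

end

section \<open>Passage from almost every to every point\<close>

lemma young_function_id: "young_function (\<lambda>u. u)"
proof -
  have "x \<le> Liminf (at x) (\<lambda>u. u)" for x :: ennreal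
  proof (cases "at x = bot")
    case False
    then have "Liminf (at x) (\<lambda>u. u) = x" by (intro lim_imp_Liminf tendsto_ident_at)
    then show ?thesis by simp
  qed (simp add: Liminf_def)
  then show ?thesis by (simp add: young_function_def)
qed

lemma musielak_pairI:
  assumes "sigma_finite_measure M" "\<And>t. young_function (\<Phi> t)" "\<And>u. (\<lambda>t. \<Phi> t u) \<in> borel_measurable M"
  shows "musielak_pair M \<Phi>"
proof -
  interpret sigma_finite_measure M by fact
  note [measurable] = assms(3)
  have sup: "complementary \<Phi> t (ennreal u) = (SUP i. ennreal (nnrat i * u) - \<Phi> t (ennreal (nnrat i)))"
    if "0 \<le> u" for t u
    unfolding complementary_eq_conjugate
    by (rule conjugate_eq_SUP_nnrat[OF young_function_star_shaped[OF assms(2)] that])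
  show ?thesis
  proof unfold_locales
    show "\<Phi> t (ennreal u) = (SUP i. ennreal (nnrat i * u) - complementary \<Phi> t (ennreal (nnrat i)))"
      if "0 \<le> u" for t u
      unfolding complementary_eq_conjugate by (rule young_function_biconjugate[OF assms(2) that])
    show "ennreal (u * v) \<le> \<Phi> t (ennreal u) + complementary \<Phi> t (ennreal v)"
      if "0 \<le> u" "0 \<le> v" for t u v
      unfolding complementary_eq_conjugate by (rule Young_inequality[OF that])
    show "star_shaped (\<Phi> t)" for t by (rule young_function_star_shaped[OF assms(2)])
    show "star_shaped (complementary \<Phi> t)" for t
      unfolding complementary_eq_conjugate by (rule star_shaped_conjugate)
    show "(\<lambda>t. complementary \<Phi> t (ennreal (nnrat i))) \<in> borel_measurable M" for i
      unfolding sup[OF nnrat_nonneg] by measurable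
  qed (use sup assms(3) in \<open>auto\<close>)
qed

theorem proposition8:
  fixes M :: "'a measure" and \<Phi> :: "'a \<Rightarrow> ennreal \<Rightarrow> ennreal"
    and f fs :: "('a \<Rightarrow> real) \<Rightarrow> real" and v :: "'a \<Rightarrow> real"
  assumes "sigma_finite_measure M" and "nonatomic M" and "musielak_orlicz M \<Phi>"
    and "f \<in> orlicz_dual M \<Phi>"
    and "v \<in> orlicz_space M (complementary \<Phi>)"
    and "fs \<in> orlicz_dual M \<Phi>" and "purely_singular M \<Phi> fs"
    and "\<And>u. u \<in> orlicz_space M \<Phi> \<Longrightarrow> f u = (\<integral>t. u t * v t \<partial>M) + fs u"
  shows "functional_norm M \<Phi> f =
    (INF l\<in>{l::real. 0 < l \<and>
        modular M (complementary \<Phi>) (\<lambda>t. v t / l) + functional_norm M \<Phi> (\<lambda>u. fs u / l) \<le> 1}.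
      ennreal l)"
proof -
  have "AE t in M. young_function (\<Phi> t)"
    using assms(3) unfolding musielak_orlicz_def young_function_def by (auto elim!: eventually_mono)
  then obtain N where N: "N \<in> null_sets M" "{t \<in> space M. \<not> young_function (\<Phi> t)} \<subseteq> N"
    by (auto elim: AE_E simp: null_sets_def)
  define G where "G = space M - N"
  have G [measurable]: "G \<in> sets M" using N(1) by (auto simp: G_def)
  \<comment> \<open>\<open>\<Phi>\<close> is only known to be a Young function outside a null set; changing it there
    affects neither modular, hence none of the notions of the theorem.\<close>
  define \<Phi>' where "\<Phi>' t u = (if t \<in> G then \<Phi> t u else u)" for t u
  have young: "young_function (\<Phi>' t)" for t
  proof (cases "t \<in> G")
    case True
    then have "young_function (\<Phi> t)" "\<Phi>' t = \<Phi> t" using N(2) by (auto simp: G_def \<Phi>'_def)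
    then show ?thesis by simp
  next
    case False
    then have "\<Phi>' t = (\<lambda>u. u)" by (simp add: \<Phi>'_def fun_eq_iff)
    then show ?thesis by (simp add: young_function_id)
  qed
  have meas: "(\<lambda>t. \<Phi>' t u) \<in> borel_measurable M" for u
  proof -
    have [measurable]: "(\<lambda>t. \<Phi> t u) \<in> borel_measurable M" using assms(3) by (simp add: musielak_orlicz_def)
    show ?thesis unfolding \<Phi>'_def by measurable
  qed
  have "AE t in M. t \<in> G" using AE_not_in[OF N(1)] AE_space by eventually_elim (simp add: G_def)
  then have AE: "AE t in M. \<Phi>' t = \<Phi> t" by eventually_elim (simp add: \<Phi>'_def fun_eq_iff)
  have m1: "modular M \<Phi> = modular M \<Phi>'"
    unfolding modular_def using AE by (intro ext nn_integral_cong_AE) (auto elim!: eventually_mono)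
  have m2: "modular M (complementary \<Phi>) = modular M (complementary \<Phi>')"
    unfolding modular_def complementary_def using AE
    by (intro ext nn_integral_cong_AE) (auto elim!: eventually_mono)
  have space: "orlicz_space M \<Phi> = orlicz_space M \<Phi>'"
    "orlicz_space M (complementary \<Phi>) = orlicz_space M (complementary \<Phi>')"
    unfolding orlicz_space_def m1 m2 by rule+
  have norm: "orlicz_norm M \<Phi> = orlicz_norm M \<Phi>'"
    unfolding orlicz_norm_def orlicz_class_def m2 ..
  have fnorm: "functional_norm M \<Phi> = functional_norm M \<Phi>'"
    unfolding functional_norm_def space norm ..
  have dual: "orlicz_dual M \<Phi> = orlicz_dual M \<Phi>'"
    unfolding orlicz_dual_def space fnorm ..
  \<comment> \<open>Pure singularity refers to \<open>\<Phi>\<close> only through the Orlicz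
    space.\<close>
  have sing: "purely_singular M \<Phi> = purely_singular M \<Phi>'"
    unfolding purely_singular_def oc_component_def oc_component_of_positive_def increasing_to_def
      functional_neg_part_def functional_pos_part_def space ..
  interpret musielak_pair M \<Phi>' by (rule musielak_pairI[OF assms(1) young meas])
  show ?thesis
    using functional_norm_formula[of f fs v] assms(4-8)
    unfolding space norm fnorm dual sing m2 by blast
qed

end
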